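(* Let $\lambda,\mu$ be sigma-finite measures on a measurable space $(S_1,\mathcal S_1)$ and let $K,L$ be probability kernels from $(S_1,\mathcal S_1)$ into a measurable space $(S_2,\mathcal S_2)$. If $\xi,\zeta$ are marked Poisson PPs with intensity measures $\lambda,\mu$ and mark kernels $K,L$, respectively, then for every $\alpha>0$ the R\'enyi divergence of order $\alpha$ of their laws is given by $$R_\alpha(\mathcal L(\xi)\|\mathcal L(\zeta))=T_\alpha(\lambda\otimes K\|\mu\otimes L).$$
   Context: Point patterns: for a measurable space $(S,\mathcal S)$, $N(S)$ is the set of measures on $(S,\mathcal S)$ that can be written as a countable sum of integer-valued finite measures, equipped with the sigma-algebra $\mathcal N(S)$ generated by the evaluation maps $\eta\mapsto\eta(B)$, $B\in\mathcal S$. For a sigma-finite measure $\lambda$ on $(S,\mathcal S)$, the Poisson PP distribution $P_\lambda$ is the unique probability measure on $(N(S),\mathcal N(S))$ under which $\eta(B_1),\dots,\eta(B_n)$ are independent for mutually disjoint $B_1,\dots,B_n\in\mathcal S$, and $\eta(B)$ is Poisson distributed with mean $\lambda(B)$ for every $B\in\mathcal S$ (with $\mathrm{Poi}(0)=\delta_0$, $\mathrm{Poi}(\infty)=\delta_\infty$). For a measure $\lambda$ on $(S_1,\mathcal S_1)$ and a kernel $K$ from $(S_1,\mathcal S_1)$ into $(S_2,\mathcal S_2)$: $(\lambda\otimes K)(C)=\int_{S_1}\int_{S_2}1_C(x,y)\,K_x(dy)\,\lambda(dx)$ for $C\in\mathcal S_1\otimes\mathcal S_2$. A marked Poisson PP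 with intensity measure $\lambda$ and mark kernel $K$ is a random point pattern $\xi$ on $S_1\times S_2$ with law $\mathcal L(\xi)=P_{\lambda\otimes K}$. Conventions: for $\alpha>1$, $f^\alpha g^{1-\alpha}$ is read as $\frac{f^\alpha}{g^{\alpha-1}}$; $\frac00=0$ and $\frac t0=\infty$ for $t>0$; $t\log\frac t0=\infty$ for $t>0$; $0\log\frac0t=0$ for $t\ge0$. Tsallis divergence of sigma-finite measures $\Lambda,\Lambda'$ with densities $f,g$ with respect to a sigma-finite measure $\nu$ (the value does not depend on the choice): $T_\alpha(\Lambda\|\Lambda')=\int\frac{\alpha f+(1-\alpha)g-f^\alpha g^{1-\alpha}}{1-\alpha}\,d\nu$ for $\alpha\notin\{0,1\}$; $T_1(\Lambda\|\Lambda')=\int\left(f\log\frac fg+g-f\right)d\nu$. R\'enyi divergence of probability measures $P,Q$ with densities $p,q$ with respect to a sigma-finite measure $m$ (the value does not depend on the choice), same conventions: $R_\alpha(P\|Q)=\frac1{\alpha-1}\log\int p^\alpha q^{1-\alpha}\,dm$ for $\alpha\notin\{0,1\}$; $R_1(P\|Q)=\int p\log\frac pq\,dm$. *)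

theory Defs
  imports "HOL-Probability.Probability"
begin

section \<open>Point patterns\<close>

definition integer_valued :: "'a measure \<Rightarrow> bool" where
  "integer_valued \<kappa> \<longleftrightarrow> (\<forall>B\<in>sets \<kappa>. \<exists>n::nat. emeasure \<kappa> B = of_nat n)"

text \<open>Here and below a measure \<open>S\<close> that only plays the role of a measurable space contributes
  its \<^const>\<open>space\<close> and \<^const>\<open>sets\<close>. Summands may be zero, so finite sums are included.\<close>

definition point_patterns :: "'a measure \<Rightarrow> 'a measure set" where
  "point_patterns S = {\<eta>. sets \<eta> = sets S \<and>
     (\<exists>\<kappa> :: nat \<Rightarrow> 'a measure.
        (\<forall>i. sets (\<kappa> i) = sets S \<and> finite_measure (\<kappa> i) \<and> integer_valued (\<kappa> i)) \<and>
        (\<forall>B\<in>sets S. emeasure \<eta> B = (\<Sum>i. emeasure (\<kappa> i) B)))}"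

definition point_pattern_space :: "'a measure \<Rightarrow> 'a measure measure" where
  "point_pattern_space S = sigma (point_patterns S)
     {(\<lambda>\<eta>. emeasure \<eta> B) -` A \<inter> point_patterns S | A B. A \<in> sets borel \<and> B \<in> sets S}"


section \<open>Poisson point patterns\<close>

definition poisson_law :: "ennreal \<Rightarrow> ennreal measure" where
  "poisson_law r =
     (if r = 0 then return borel 0
      else if r = \<infinity> then return borel \<infinity>
      else distr (measure_pmf (poisson_pmf (enn2real r))) borel of_nat)"

text \<open>\<open>P\<close> is the distribution of a Poisson point pattern with intensity measure \<open>lam\<close>.
  There is at most one such \<open>P\<close>, and there is one if \<open>lam\<close> is sigma-finite.\<close>

definition poisson_pp_distribution :: "'a measure \<Rightarrow> 'a measure measure \<Rightarrow> bool" where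
  "poisson_pp_distribution lam P \<longleftrightarrow>
     prob_space P \<and> sets P = sets (point_pattern_space lam) \<and>
     (\<forall>(n::nat) B. (\<forall>i<n. B i \<in> sets lam) \<longrightarrow> disjoint_family_on B {..<n} \<longrightarrow>
        prob_space.indep_vars P (\<lambda>_. borel) (\<lambda>i \<eta>. emeasure \<eta> (B i)) {..<n}) \<and>
     (\<forall>B\<in>sets lam. distr P borel (\<lambda>\<eta>. emeasure \<eta> B) = poisson_law (emeasure lam B))"

definition measure_kernel_prod ::
    "'a measure \<Rightarrow> 'b measure \<Rightarrow> ('a \<Rightarrow> 'b measure) \<Rightarrow> ('a \<times> 'b) measure" where
  "measure_kernel_prod lam S\<^sub>2 K =
     measure_of (space lam \<times> space S\<^sub>2) (sets (lam \<Otimes>\<^sub>M S\<^sub>2))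
       (\<lambda>C. \<integral>\<^sup>+x. \<integral>\<^sup>+y. indicator C (x, y) \<partial>K x \<partial>lam)"

definition law_pp :: "'w measure \<Rightarrow> 's measure \<Rightarrow> ('w \<Rightarrow> 's measure) \<Rightarrow> 's measure measure" where
  "law_pp M S \<xi> = distr M (point_pattern_space S) \<xi>"

definition marked_poisson_pp :: "'w measure \<Rightarrow> 'a measure \<Rightarrow> 'b measure \<Rightarrow> 'a measure \<Rightarrow>
    ('a \<Rightarrow> 'b measure) \<Rightarrow> ('w \<Rightarrow> ('a \<times> 'b) measure) \<Rightarrow> bool" where
  "marked_poisson_pp M S\<^sub>1 S\<^sub>2 lam K \<xi> \<longleftrightarrow>
     prob_space M \<and> \<xi> \<in> M \<rightarrow>\<^sub>M point_pattern_space (S\<^sub>1 \<Otimes>\<^sub>M S\<^sub>2) \<and>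
     poisson_pp_distribution (measure_kernel_prod lam S\<^sub>2 K) (law_pp M (S\<^sub>1 \<Otimes>\<^sub>M S\<^sub>2) \<xi>)"


section \<open>Divergences\<close>

text \<open>The integral of an extended real function as the difference of the integrals of its positive
  and negative parts (\<^const>\<open>e2ennreal\<close> truncates at 0). In the divergences below the negative
  part always has a finite integral.\<close>

definition ext_integral :: "'a measure \<Rightarrow> ('a \<Rightarrow> ereal) \<Rightarrow> ereal" where
  "ext_integral M h =
     enn2ereal (\<integral>\<^sup>+x. e2ennreal (h x) \<partial>M) - enn2ereal (\<integral>\<^sup>+x. e2ennreal (- h x) \<partial>M)"

definition ext_ln :: "ereal \<Rightarrow> ereal" where
  "ext_ln x = (if x \<le> 0 then -\<infinity> else if x = \<infinity> then \<infinity> else ereal (ln (real_of_ereal x)))"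

text \<open>\<open>f\<^sup>\<alpha> g\<^sup>1\<^sup>-\<^sup>\<alpha>\<close> for \<open>f, g \<ge> 0\<close> and \<open>\<alpha> > 0\<close>, \<open>\<alpha> \<noteq> 1\<close>, where for \<open>\<alpha> > 1\<close>
  it is read as a quotient with \<open>0/0 = 0\<close> and \<open>t/0 = \<infinity>\<close> for \<open>t > 0\<close>.\<close>

definition powr_prod :: "real \<Rightarrow> real \<Rightarrow> real \<Rightarrow> ereal" where
  "powr_prod \<alpha> f g =
     (if \<alpha> > 1 then
        (if g = 0 then (if f = 0 then 0 else \<infinity>) else ereal (f powr \<alpha> / g powr (\<alpha> - 1)))
      else ereal (f powr \<alpha> * g powr (1 - \<alpha>)))"

text \<open>\<open>f log (f/g)\<close> for \<open>f, g \<ge> 0\<close>, with \<open>0 log (0/t) = 0\<close> for \<open>t \<ge> 0\<close> and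
  \<open>t log (t/0) = \<infinity>\<close> for \<open>t > 0\<close>.\<close>

definition xln_ratio :: "real \<Rightarrow> real \<Rightarrow> ereal" where
  "xln_ratio f g = (if f = 0 then 0 else if g = 0 then \<infinity> else ereal (f * ln (f / g)))"

text \<open>Densities of sigma-finite measures with respect to sigma-finite measures are finite almost
  everywhere, so they are taken real-valued.\<close>

definition has_density :: "'a measure \<Rightarrow> 'a measure \<Rightarrow> ('a \<Rightarrow> real) \<Rightarrow> bool" where
  "has_density \<nu> \<Lambda> f \<longleftrightarrow>
     f \<in> borel_measurable \<nu> \<and> (\<forall>x\<in>space \<nu>. 0 \<le> f x) \<and> \<Lambda> = density \<nu> (\<lambda>x. ennreal (f x))"

definition tsallis_integral ::
    "real \<Rightarrow> 'a measure \<Rightarrow> ('a \<Rightarrow> real) \<Rightarrow> ('a \<Rightarrow> real) \<Rightarrow> ereal" where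
  "tsallis_integral \<alpha> \<nu> f g =
     (if \<alpha> = 1 then ext_integral \<nu> (\<lambda>x. xln_ratio (f x) (g x) + ereal (g x) - ereal (f x))
      else ext_integral \<nu> (\<lambda>x.
        (ereal (\<alpha> * f x + (1 - \<alpha>) * g x) - powr_prod \<alpha> (f x) (g x)) / ereal (1 - \<alpha>)))"

definition renyi_integral ::
    "real \<Rightarrow> 'a measure \<Rightarrow> ('a \<Rightarrow> real) \<Rightarrow> ('a \<Rightarrow> real) \<Rightarrow> ereal" where
  "renyi_integral \<alpha> m p q =
     (if \<alpha> = 1 then ext_integral m (\<lambda>x. xln_ratio (p x) (q x))
      else ereal (1 / (\<alpha> - 1)) * ext_ln (ext_integral m (\<lambda>x. powr_prod \<alpha> (p x) (q x))))"

text \<open>The divergences, of order \<open>\<alpha> > 0\<close>. The value exists and is unique for sigma-finite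
  measures on the same measurable space, because \<open>\<Lambda> + \<Lambda>'\<close> dominates both and the
  integrals do not depend on the dominating measure or the densities.\<close>

definition tsallis_divergence :: "real \<Rightarrow> 'a measure \<Rightarrow> 'a measure \<Rightarrow> ereal" where
  "tsallis_divergence \<alpha> \<Lambda> \<Lambda>' =
     (THE t. \<exists>\<nu> f g. sigma_finite_measure \<nu> \<and> has_density \<nu> \<Lambda> f \<and> has_density \<nu> \<Lambda>' g \<and>
        t = tsallis_integral \<alpha> \<nu> f g)"

definition renyi_divergence :: "real \<Rightarrow> 'a measure \<Rightarrow> 'a measure \<Rightarrow> ereal" where
  "renyi_divergence \<alpha> P Q =
     (THE r. \<exists>m p q. sigma_finite_measure m \<and> has_density m P p \<and> has_density m Q q \<and>
        r = renyi_integral \<alpha> m p q)"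

end

theory Submission
  imports Defs "HOL-Real_Asymp.Real_Asymp"
begin

text \<open>The Tsallis divergence \<open>T \<alpha>\<close> integrates a convex function of the two densities that is homogeneous
  of degree one. Such a function is the supremum of its tangent planes, so the integral is the supremum of
  sums \<open>u\<^sub>k \<Lambda>(A\<^sub>k) + v\<^sub>k \<Lambda>'(A\<^sub>k)\<close> over finite disjoint families \<open>A\<^sub>k\<close> of sets of finite measure.
  For the laws \<open>P, Q\<close> of the Poisson point patterns it suffices to use sets \<open>A\<^sub>k\<close> from the algebra of
  cylinders, since these sums are continuous in the \<open>A\<^sub>k\<close>. Hence the divergence of \<open>P, Q\<close> is the
  supremum of those of the count vectors \<open>(\<eta>(B\<^sub>1), ..., \<eta>(B\<^sub>n))\<close> with disjoint \<open>B\<^sub>i\<close>. The counts are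
  independent Poisson variables, whose Hellinger integrals multiply, so that the Renyi divergence of a
  count vector is the sum over \<open>i\<close> of the Tsallis integrand at \<open>\<Lambda>(B\<^sub>i), \<Lambda>'(B\<^sub>i)\<close>. The supremum of these sums is
  \<open>T \<alpha>\<close> of \<open>\<Lambda>, \<Lambda>'\<close>. As both divergences increase with the order below one, the case \<open>\<alpha> = 1\<close> is a
  monotone limit.\<close>


section \<open>The Tsallis integrand and its tangents\<close>

text \<open>Two Poisson laws have no explicit likelihood ratio in general: for intensities of
  infinite mass they can be mutually singular although the intensities are equivalent, and nothing
  is assumed about the measurable spaces. Explicit are only the laws of finitely many counts.
  Everything therefore has to be expressed by quantities that can be computed on a generating
  algebra, which an integral over densities is not. Homogeneity of the integrand is what removes the
  densities: a linear function u f + v g integrated over a set A depends on the masses \<Lambda>(A)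
  and \<Lambda>'(A) alone. The linear part \<alpha> f + (1 - \<alpha>) g makes the integrand
  nonnegative, so all divergences live in \<open>ennreal\<close> and intensities of infinite mass
  produce no difference of infinities. At order one the slopes of the tangents take the form 0/0,
  which is why that order is reached by a limit and not by tangents of its own.\<close>

definition tsallis_fun :: "real \<Rightarrow> real \<Rightarrow> real \<Rightarrow> ennreal" where
  "tsallis_fun \<alpha> a b = e2ennreal (if \<alpha> = 1 then xln_ratio a b + ereal b - ereal a
     else (ereal (\<alpha> * a + (1 - \<alpha>) * b) - powr_prod \<alpha> a b) / ereal (1 - \<alpha>))"

text \<open>The plane that touches the graph of the homogeneous convex function \<open>tsallis_fun \<alpha>\<close> along
  the ray \<open>a = t b\<close>.\<close>

definition tangent :: "real \<Rightarrow> real \<Rightarrow> real \<Rightarrow> real \<Rightarrow> real" where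
  "tangent \<alpha> t a b = \<alpha> * (1 - t powr (\<alpha> - 1)) / (1 - \<alpha>) * a + (1 - t powr \<alpha>) * b"

lemma tsallis_fun_real:
  assumes "\<alpha> \<noteq> 1" "\<alpha> < 1 \<or> b > 0" "0 \<le> a" "0 \<le> b"
  shows "tsallis_fun \<alpha> a b = ennreal ((\<alpha> * a + (1 - \<alpha>) * b - a powr \<alpha> * b powr (1 - \<alpha>)) / (1 - \<alpha>))"
proof (cases "\<alpha> < 1")
  case True then show ?thesis
    by (simp add: tsallis_fun_def powr_prod_def)
next
  case False
  have "b powr (1 - \<alpha>) = 1 / b powr (\<alpha> - 1)" using powr_minus_divide[of b "\<alpha> - 1"] by simp
  then show ?thesis using False assms by (simp add: tsallis_fun_def powr_prod_def)
qed

lemma tsallis_fun_top: "\<alpha> > 1 \<Longrightarrow> 0 < a \<Longrightarrow> tsallis_fun \<alpha> a 0 = \<top>"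
  by (simp add: tsallis_fun_def powr_prod_def divide_ereal_def ereal_mult_eq_PInfty)

lemma tsallis_fun_0_0: "tsallis_fun \<alpha> 0 0 = 0"
  by (simp add: tsallis_fun_def powr_prod_def xln_ratio_def flip: zero_ereal_def)

lemma tsallis_fun_0_left: "\<alpha> > 0 \<Longrightarrow> \<alpha> \<noteq> 1 \<Longrightarrow> 0 \<le> b \<Longrightarrow> tsallis_fun \<alpha> 0 b = ennreal b"
  by (cases "b = 0") (simp_all add: tsallis_fun_0_0 tsallis_fun_real)

lemma Young_powr:
  fixes x y :: real
  assumes "0 < \<alpha>" "\<alpha> < 1" "0 \<le> x" "0 \<le> y"
  shows "x powr \<alpha> * y powr (1 - \<alpha>) \<le> \<alpha> * x + (1 - \<alpha>) * y"
  using assms Youngs_inequality_0[of \<alpha> "1 - \<alpha>" x y]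
  by (cases "x = 0 \<or> y = 0") auto

section \<open>Tangent planes as lower bounds and their supremum\<close>

lemma tangent_times:
  assumes "\<alpha> \<noteq> 1"
  shows "(1 - \<alpha>) * tangent \<alpha> t a b =
    \<alpha> * a + (1 - \<alpha>) * b - (\<alpha> * (t powr (\<alpha> - 1) * a) + (1 - \<alpha>) * (t powr \<alpha> * b))"
  using assms by (simp add: tangent_def field_simps)

text \<open>Young's inequality in two disguises. Below order one it is applied to t^(\<alpha>-1) a
  and t^\<alpha> b with weights \<alpha> and 1 - \<alpha>; the powers of t cancel in the product.
  Above order one the weights are 1/\<alpha> and 1 - 1/\<alpha>, applied to a^\<alpha>
  b^(1-\<alpha>) and t^\<alpha> b; here the powers of b cancel.\<close>

lemma tangent_le_real:
  assumes "0 < \<alpha>" "\<alpha> \<noteq> 1" "\<alpha> < 1 \<or> b > 0" "0 \<le> a" "0 \<le> b" "0 < t"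
  shows "tangent \<alpha> t a b \<le> (\<alpha> * a + (1 - \<alpha>) * b - a powr \<alpha> * b powr (1 - \<alpha>)) / (1 - \<alpha>)"
proof -
  note eq = tangent_times[OF assms(2), of t a b]
  show ?thesis
  proof (cases "\<alpha> < 1")
    case True
    let ?x = "t powr (\<alpha> - 1) * a" and ?y = "t powr \<alpha> * b"
    have "?x powr \<alpha> * ?y powr (1 - \<alpha>) = t powr ((\<alpha> - 1) * \<alpha> + \<alpha> * (1 - \<alpha>)) * (a powr \<alpha> * b powr (1 - \<alpha>))"
      using assms by (simp add: powr_mult powr_powr powr_add)
    also have "(\<alpha> - 1) * \<alpha> + \<alpha> * (1 - \<alpha>) = 0" by (simp add: algebra_simps)
    finally have "a powr \<alpha> * b powr (1 - \<alpha>) \<le> \<alpha> * ?x + (1 - \<alpha>) * ?y"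
      using Young_powr[of \<alpha> ?x ?y] assms True by simp
    then have "(1 - \<alpha>) * tangent \<alpha> t a b \<le> \<alpha> * a + (1 - \<alpha>) * b - a powr \<alpha> * b powr (1 - \<alpha>)"
      unfolding eq by (simp add: algebra_simps)
    then show ?thesis using True by (simp add: pos_le_divide_eq mult.commute)
  next
    case False
    then have \<alpha>: "\<alpha> > 1" and b: "b > 0" using assms by auto
    let ?x = "a powr \<alpha> * b powr (1 - \<alpha>)" and ?y = "t powr \<alpha> * b"
    have "?x powr (1/\<alpha>) * ?y powr (1 - 1/\<alpha>) = a powr (\<alpha> * (1/\<alpha>)) * t powr (\<alpha> * (1 - 1/\<alpha>)) * b powr ((1 - \<alpha>) * (1/\<alpha>) + (1 - 1/\<alpha>))"
      using assms by (simp add: powr_mult powr_powr powr_add del: times_divide_eq_right)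
    also have "(1 - \<alpha>) * (1/\<alpha>) + (1 - 1/\<alpha>) = 0" using \<alpha> by (simp add: field_simps)
    also have "\<alpha> * (1 - 1/\<alpha>) = \<alpha> - 1" using \<alpha> by (simp add: field_simps)
    also have "\<alpha> * (1/\<alpha>) = 1" using \<alpha> by simp
    finally have "a * t powr (\<alpha> - 1) \<le> 1/\<alpha> * ?x + (1 - 1/\<alpha>) * ?y"
      using Young_powr[of "1/\<alpha>" ?x ?y] assms \<alpha> b by simp
    then have "\<alpha> * (a * t powr (\<alpha> - 1)) \<le> \<alpha> * (1/\<alpha> * ?x + (1 - 1/\<alpha>) * ?y)"
      using \<alpha> by (intro mult_left_mono) auto
    also have "\<dots> = ?x + (\<alpha> - 1) * ?y" using \<alpha> by (simp add: field_simps)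
    finally have "(1 - \<alpha>) * tangent \<alpha> t a b \<ge> \<alpha> * a + (1 - \<alpha>) * b - a powr \<alpha> * b powr (1 - \<alpha>)"
      unfolding eq by (simp add: algebra_simps)
    then show ?thesis using \<alpha> by (simp add: neg_le_divide_eq mult.commute)
  qed
qed

lemma tangent_le_tsallis_fun:
  assumes "0 < \<alpha>" "\<alpha> \<noteq> 1" "0 \<le> a" "0 \<le> b" "0 < t"
  shows "ennreal (tangent \<alpha> t a b) \<le> tsallis_fun \<alpha> a b"
proof (cases "\<alpha> < 1 \<or> b > 0")
  case True
  then show ?thesis using assms tangent_le_real[of \<alpha> b a t] tsallis_fun_real[of \<alpha> b a]
    by (auto intro!: ennreal_leI)
next
  case False
  then show ?thesis using assms tsallis_fun_top[of \<alpha> a] tsallis_fun_0_0[of \<alpha>]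
    by (cases "a = 0") (auto simp: tangent_def)
qed

lemma tsallis_fun_nonneg_real:
  fixes \<alpha> a b :: real
  assumes "0 < \<alpha>" "\<alpha> \<noteq> 1" "\<alpha> < 1 \<or> b > 0" "0 \<le> a" "0 \<le> b"
  shows "0 \<le> (\<alpha> * a + (1 - \<alpha>) * b - a powr \<alpha> * b powr (1 - \<alpha>)) / (1 - \<alpha>)"
  using tangent_le_real[OF assms zero_less_one] by (simp add: tangent_def)

text \<open>The tangent touches at t = a / b when both arguments are positive. On the boundary the
  value is only a limit: t tends to 0 for a = 0 and to infinity for b = 0, where above order one the
  limit is infinite, in accordance with the convention for division by 0.\<close>

lemma tsallis_fun_le_SUP_tangent:
  assumes "0 < \<alpha>" "\<alpha> \<noteq> 1" "0 \<le> a" "0 \<le> b"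
  shows "tsallis_fun \<alpha> a b \<le> (SUP t\<in>{0<..}. ennreal (tangent \<alpha> t a b))"
proof -
  have lim: ?thesis if "((\<lambda>t. ennreal (tangent \<alpha> t a b)) \<longlongrightarrow> tsallis_fun \<alpha> a b) F" "F \<noteq> bot"
    "eventually (\<lambda>t. t > 0) F" for F
    by (rule tendsto_upperbound[OF that(1) _ that(2)])
      (use that(3) in \<open>auto elim!: eventually_mono intro: SUP_upper\<close>)
  consider "a = 0" | "a > 0" "b > 0" | "a > 0" "b = 0" using assms by fastforce
  then show ?thesis
  proof cases
    case 1
    have "((\<lambda>t. tangent \<alpha> t 0 b) \<longlongrightarrow> (1 - 0) * b) (at_right 0)"
    proof -
      have "((\<lambda>t. t powr \<alpha>) \<longlongrightarrow> 0) (at_right 0)" using assms(1) by real_asymp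
      then show ?thesis unfolding tangent_def mult_zero_right add_0_left by (intro tendsto_intros)
    qed
    then have "((\<lambda>t. ennreal (tangent \<alpha> t a b)) \<longlongrightarrow> tsallis_fun \<alpha> a b) (at_right 0)"
      using 1 assms by (simp add: tsallis_fun_0_left)
    then show ?thesis by (rule lim) (auto simp: eventually_at_right_less)
  next
    case 2
    let ?t = "a / b"
    have *: "(a / b) powr (\<alpha> - 1) * a = a powr \<alpha> * b powr (1 - \<alpha>)"
      "(a / b) powr \<alpha> * b = a powr \<alpha> * b powr (1 - \<alpha>)"
      using 2 by (simp_all add: powr_divide powr_diff field_simps)
    have "(1 - \<alpha>) * tangent \<alpha> ?t a b = \<alpha> * a + (1 - \<alpha>) * b - (\<alpha> * ((a / b) powr (\<alpha> - 1) * a) + (1 - \<alpha>) * ((a / b) powr \<alpha> * b))"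
      by (rule tangent_times[OF assms(2)])
    also have "\<dots> = \<alpha> * a + (1 - \<alpha>) * b - a powr \<alpha> * b powr (1 - \<alpha>)"
      unfolding * by (simp add: algebra_simps)
    finally have "tangent \<alpha> ?t a b = (\<alpha> * a + (1 - \<alpha>) * b - a powr \<alpha> * b powr (1 - \<alpha>)) / (1 - \<alpha>)"
      using assms(2) by (simp add: field_simps)
    then have "tsallis_fun \<alpha> a b = ennreal (tangent \<alpha> ?t a b)"
      using 2 assms by (simp add: tsallis_fun_real)
    moreover have "?t \<in> {0<..}" using 2 by simp
    ultimately show ?thesis by (metis SUP_upper)
  next
    case 3
    show ?thesis
    proof (cases "\<alpha> < 1")
      case True
      have "((\<lambda>t. tangent \<alpha> t a 0) \<longlongrightarrow> \<alpha> * (1 - 0) / (1 - \<alpha>) * a + 0) at_top"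
        unfolding tangent_def mult_zero_right
        using True by (intro tendsto_intros tendsto_neg_powr filterlim_ident) auto
      then have "((\<lambda>t. ennreal (tangent \<alpha> t a b)) \<longlongrightarrow> tsallis_fun \<alpha> a b) at_top"
        using 3 assms True by (simp add: tsallis_fun_real)
      then show ?thesis by (rule lim) (auto simp: eventually_gt_at_top)
    next
      case False
      then have \<alpha>: "\<alpha> > 1" using assms by auto
      have "filterlim (\<lambda>t::real. t powr (\<alpha> - 1)) at_top at_top"
        using \<alpha> by real_asymp
      then have "filterlim (\<lambda>t. - 1 + t powr (\<alpha> - 1)) at_top at_top"
        by (rule filterlim_tendsto_add_at_top[OF tendsto_const])
      then have "filterlim (\<lambda>t. \<alpha> / (\<alpha> - 1) * a * (- 1 + t powr (\<alpha> - 1))) at_top at_top"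
        using \<alpha> 3 by (intro filterlim_tendsto_pos_mult_at_top[OF tendsto_const]) auto
      moreover have "\<alpha> / (\<alpha> - 1) * a * (- 1 + t powr (\<alpha> - 1)) = tangent \<alpha> t a b" for t
        using \<alpha> 3 by (simp add: tangent_def divide_simps) (simp add: algebra_simps)
      ultimately have "filterlim (\<lambda>t. tangent \<alpha> t a b) at_top at_top" by simp
      then have "((\<lambda>t. ennreal (tangent \<alpha> t a b)) \<longlongrightarrow> tsallis_fun \<alpha> a b) at_top"
        using 3 \<alpha> by (simp add: tsallis_fun_top ennreal_tendsto_top_eq_at_top)
      then show ?thesis by (rule lim) (auto simp: eventually_gt_at_top)
    qed
  qed
qed

text \<open>The enumeration starts with \<open>1\<close>, where the tangent vanishes, so that maxima over initial
  segments are nonnegative.\<close>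

definition pos_rat :: "nat \<Rightarrow> real" where
  "pos_rat n = (case prod_decode n of (i, j) \<Rightarrow> (real i + 1) / (real j + 1))"

lemma pos_rat_pos: "pos_rat n > 0"
  by (auto simp: pos_rat_def split: prod.split)

lemma pos_rat_0: "pos_rat 0 = 1"
  by (simp add: pos_rat_def prod_decode_def prod_decode_aux.simps)

lemma pos_rat_dense:
  assumes "open U" "t \<in> U" "t > 0" shows "\<exists>n. pos_rat n \<in> U"
proof -
  have "open (U \<inter> {0<..})" "t \<in> U \<inter> {0<..}" using assms by auto
  then obtain e where e: "e > 0" "\<And>s. dist s t < e \<Longrightarrow> s \<in> U \<inter> {0<..}"
    by (metis open_dist)
  obtain r where r: "r \<in> \<rat>" "t < r" "r < t + e" using Rats_dense_in_real[of t "t + e"] e by auto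
  have rU: "r \<in> U" "r > 0" using e(2)[of r] r by (auto simp: dist_real_def)
  obtain m n where mn: "n \<noteq> 0" "\<bar>r\<bar> = real m / real n"
    using Rats_abs_nat_div_natE[OF r(1)] by metis
  then have "m \<noteq> 0" using rU by (intro notI) simp
  then have "real (m - 1) + 1 = real m" "real (n - 1) + 1 = real n" using mn by linarith+
  then have "pos_rat (prod_encode (m - 1, n - 1)) = r" using mn rU
    by (simp add: pos_rat_def)
  then show ?thesis using rU by metis
qed

text \<open>Continuity of the tangents in t allows a countable set of parameters. Countability is
  what makes monotone convergence and a measurable choice of the best tangent possible
  later.\<close>

lemma tsallis_fun_eq_SUP_tangent:
  assumes "0 < \<alpha>" "\<alpha> \<noteq> 1" "0 \<le> a" "0 \<le> b"
  shows "tsallis_fun \<alpha> a b = (SUP n. ennreal (tangent \<alpha> (pos_rat n) a b))"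
proof (rule antisym)
  have "ennreal (tangent \<alpha> t a b) \<le> (SUP n. ennreal (tangent \<alpha> (pos_rat n) a b))" if t: "t > 0" for t
  proof (rule ccontr)
    assume "\<not> ?thesis"
    then have lt: "(SUP n. ennreal (tangent \<alpha> (pos_rat n) a b)) < ennreal (tangent \<alpha> t a b)" by simp
    have "((\<lambda>t. tangent \<alpha> t a b) \<longlongrightarrow> tangent \<alpha> t a b) (at t)"
      unfolding tangent_def using t assms by (intro tendsto_intros) auto
    then have "((\<lambda>t. ennreal (tangent \<alpha> t a b)) \<longlongrightarrow> ennreal (tangent \<alpha> t a b)) (at t)" by simp
    then have "eventually (\<lambda>s. (SUP n. ennreal (tangent \<alpha> (pos_rat n) a b)) < ennreal (tangent \<alpha> s a b)) (at t)"
      using lt by (rule order_tendstoD)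
    then have "eventually (\<lambda>s. (SUP n. ennreal (tangent \<alpha> (pos_rat n) a b)) < ennreal (tangent \<alpha> s a b)) (nhds t)"
      using lt by (simp add: eventually_nhds_conv_at)
    then obtain U where U: "open U" "t \<in> U"
      "\<And>s. s \<in> U \<Longrightarrow> (SUP n. ennreal (tangent \<alpha> (pos_rat n) a b)) < ennreal (tangent \<alpha> s a b)"
      unfolding eventually_nhds by auto
    obtain n where "pos_rat n \<in> U" using pos_rat_dense[OF U(1,2) t] ..
    from U(3)[OF this] show False by (metis SUP_upper UNIV_I leD)
  qed
  then have "(SUP t\<in>{0<..}. ennreal (tangent \<alpha> t a b)) \<le> (SUP n. ennreal (tangent \<alpha> (pos_rat n) a b))"
    by (intro SUP_least) auto
  then show "tsallis_fun \<alpha> a b \<le> (SUP n. ennreal (tangent \<alpha> (pos_rat n) a b))"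
    using tsallis_fun_le_SUP_tangent[OF assms] by (rule order_trans[rotated])
  show "(SUP n. ennreal (tangent \<alpha> (pos_rat n) a b)) \<le> tsallis_fun \<alpha> a b"
    by (intro SUP_least tangent_le_tsallis_fun assms pos_rat_pos)
qed


section \<open>Variational form of the Tsallis divergence\<close>

lemma powr_prod_measurable [measurable]:
  assumes [measurable]: "f \<in> borel_measurable \<nu>" "g \<in> borel_measurable \<nu>"
  shows "(\<lambda>x. powr_prod \<alpha> (f x) (g x)) \<in> borel_measurable \<nu>"
  unfolding powr_prod_def by measurable

lemma xln_ratio_measurable [measurable]:
  assumes [measurable]: "f \<in> borel_measurable \<nu>" "g \<in> borel_measurable \<nu>"
  shows "(\<lambda>x. xln_ratio (f x) (g x)) \<in> borel_measurable \<nu>"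
  unfolding xln_ratio_def by measurable

lemma tsallis_fun_measurable [measurable]:
  assumes [measurable]: "f \<in> borel_measurable \<nu>" "g \<in> borel_measurable \<nu>"
  shows "(\<lambda>x. tsallis_fun \<alpha> (f x) (g x)) \<in> borel_measurable \<nu>"
  unfolding tsallis_fun_def divide_ereal_def by measurable

lemma tangent_measurable [measurable]:
  assumes [measurable]: "f \<in> borel_measurable \<nu>" "g \<in> borel_measurable \<nu>"
  shows "(\<lambda>x. tangent \<alpha> t (f x) (g x)) \<in> borel_measurable \<nu>"
  unfolding tangent_def by measurable

lemma has_density_emeasure:
  assumes "has_density \<nu> \<Lambda> f" "A \<in> sets \<nu>"
  shows "emeasure \<Lambda> A = (\<integral>\<^sup>+x. ennreal (f x) * indicator A x \<partial>\<nu>)"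
  using assms by (auto simp: has_density_def emeasure_density)

lemma has_density_measurable: "has_density \<nu> \<Lambda> f \<Longrightarrow> f \<in> borel_measurable \<nu>"
  by (simp add: has_density_def)

lemma has_density_sets: "has_density \<nu> \<Lambda> f \<Longrightarrow> sets \<Lambda> = sets \<nu>"
  by (simp add: has_density_def)

lemma has_density_nonneg: "has_density \<nu> \<Lambda> f \<Longrightarrow> x \<in> space \<nu> \<Longrightarrow> 0 \<le> f x"
  by (simp add: has_density_def)

lemma has_density_integral:
  assumes "has_density \<nu> \<Lambda> f" "A \<in> sets \<nu>" "emeasure \<Lambda> A < \<infinity>"
  shows "integrable \<nu> (\<lambda>x. f x * indicator A x)"
    and "(\<integral>x. f x * indicator A x \<partial>\<nu>) = measure \<Lambda> A"
proof -
  have [measurable]: "f \<in> borel_measurable \<nu>" "A \<in> sets \<nu>"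
    using assms by (auto simp: has_density_def)
  have nn: "AE x in \<nu>. 0 \<le> f x * indicator A x"
    using assms by (auto simp: has_density_def indicator_def)
  have "(\<integral>\<^sup>+x. ennreal (f x * indicator A x) \<partial>\<nu>) = emeasure \<Lambda> A"
    unfolding has_density_emeasure[OF assms(1,2)]
    by (intro nn_integral_cong) (auto simp: indicator_def)
  also have "\<dots> = ennreal (measure \<Lambda> A)"
    using assms(3) by (simp add: measure_def less_top)
  finally have *: "(\<integral>\<^sup>+x. ennreal (f x * indicator A x) \<partial>\<nu>) = ennreal (measure \<Lambda> A)" .
  then show "integrable \<nu> (\<lambda>x. f x * indicator A x)"
    using nn by (intro integrableI_nn_integral_finite) auto
  show "(\<integral>x. f x * indicator A x \<partial>\<nu>) = measure \<Lambda> A"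
    using * nn by (intro integral_eq_nn_integral[THEN trans]) auto
qed

text \<open>Jensen's inequality, obtained by integrating the tangents.\<close>

lemma tsallis_fun_measure_le:
  assumes dens: "has_density \<nu> \<Lambda> f" "has_density \<nu> \<Lambda>' g"
    and \<alpha>: "0 < \<alpha>" "\<alpha> \<noteq> 1"
    and A: "A \<in> sets \<nu>" "emeasure \<Lambda> A < \<infinity>" "emeasure \<Lambda>' A < \<infinity>"
  shows "tsallis_fun \<alpha> (measure \<Lambda> A) (measure \<Lambda>' A) \<le>
    (\<integral>\<^sup>+x. tsallis_fun \<alpha> (f x) (g x) * indicator A x \<partial>\<nu>)"
proof -
  note f = has_density_integral[OF dens(1) A(1,2)] and g = has_density_integral[OF dens(2) A(1,3)]
  have "ennreal (tangent \<alpha> t (measure \<Lambda> A) (measure \<Lambda>' A)) \<le>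
    (\<integral>\<^sup>+x. tsallis_fun \<alpha> (f x) (g x) * indicator A x \<partial>\<nu>)" if "t > 0" for t
  proof -
    \<comment> \<open>The indicator is put inside both arguments: by linearity h vanishes off A, and
      its integral is the tangent at the two masses.\<close>
    define h where "h x = tangent \<alpha> t (f x * indicator A x) (g x * indicator A x)" for x
    have int: "integrable \<nu> h"
      unfolding h_def[abs_def] tangent_def using f(1) g(1) by (intro Bochner_Integration.integrable_add integrable_mult_right)
    have "(\<integral>x. h x \<partial>\<nu>) = tangent \<alpha> t (measure \<Lambda> A) (measure \<Lambda>' A)"
      unfolding h_def tangent_def using f g by simp
    \<comment> \<open>The tangent may be negative, while \<open>ennreal\<close> truncates at 0;
      hence the comparison goes through the positive part of h.\<close>
    then have "ennreal (tangent \<alpha> t (measure \<Lambda> A) (measure \<Lambda>' A)) \<le> ennreal (\<integral>x. max 0 (h x) \<partial>\<nu>)"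
      using int by (intro ennreal_leI) (auto intro!: integral_mono simp flip: \<open>(\<integral>x. h x \<partial>\<nu>) = _\<close>)
    also have "\<dots> = (\<integral>\<^sup>+x. ennreal (max 0 (h x)) \<partial>\<nu>)"
      using int by (intro nn_integral_eq_integral[symmetric]) auto
    also have "\<dots> \<le> (\<integral>\<^sup>+x. tsallis_fun \<alpha> (f x) (g x) * indicator A x \<partial>\<nu>)"
    proof (intro nn_integral_mono)
      fix x assume "x \<in> space \<nu>"
      then show "ennreal (max 0 (h x)) \<le> tsallis_fun \<alpha> (f x) (g x) * indicator A x"
        using tangent_le_tsallis_fun[OF \<alpha> has_density_nonneg[OF dens(1)] has_density_nonneg[OF dens(2)] that, of x x]
        by (auto simp: h_def tangent_def indicator_def max_def)
    qed
    finally show ?thesis .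
  qed
  then show ?thesis
    using pos_rat_pos by (auto simp: tsallis_fun_eq_SUP_tangent[OF \<alpha>] intro!: SUP_least)
qed

text \<open>Finite mass under both measures is required because \<open>measure\<close> reads an
  infinite mass as 0, which would make the sums in \<open>var_val\<close> meaningless.\<close>

definition fin_family :: "'a measure \<Rightarrow> 'a measure \<Rightarrow> nat \<Rightarrow> (nat \<Rightarrow> 'a set) \<Rightarrow> bool" where
  "fin_family \<Lambda> \<Lambda>' m A \<longleftrightarrow> disjoint_family_on A {..<m} \<and>
    (\<forall>k<m. A k \<in> sets \<Lambda> \<and> emeasure \<Lambda> (A k) < \<infinity> \<and> emeasure \<Lambda>' (A k) < \<infinity>)"

definition var_val :: "real \<Rightarrow> 'a measure \<Rightarrow> 'a measure \<Rightarrow> nat \<Rightarrow> (nat \<Rightarrow> real) \<Rightarrow> (nat \<Rightarrow> 'a set) \<Rightarrow> real" where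
  "var_val \<alpha> \<Lambda> \<Lambda>' m t A = (\<Sum>k<m. tangent \<alpha> (t k) (measure \<Lambda> (A k)) (measure \<Lambda>' (A k)))"

text \<open>No densities occur in \<open>var_div\<close>; this is why the divergence integrals do not depend on
  the choice of them.\<close>

definition var_div :: "real \<Rightarrow> 'a measure \<Rightarrow> 'a measure \<Rightarrow> ennreal" where
  "var_div \<alpha> \<Lambda> \<Lambda>' = Sup {ennreal (var_val \<alpha> \<Lambda> \<Lambda>' m t A) | m t A. fin_family \<Lambda> \<Lambda>' m A \<and> (\<forall>k. t k > 0)}"

lemma var_val_le_var_div:
  "fin_family \<Lambda> \<Lambda>' m A \<Longrightarrow> (\<And>k. t k > 0) \<Longrightarrow> ennreal (var_val \<alpha> \<Lambda> \<Lambda>' m t A) \<le> var_div \<alpha> \<Lambda> \<Lambda>'"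
  unfolding var_div_def by (intro Sup_upper) auto

lemma var_div_least:
  assumes "\<And>m t A. fin_family \<Lambda> \<Lambda>' m A \<Longrightarrow> (\<And>k. t k > 0) \<Longrightarrow> ennreal (var_val \<alpha> \<Lambda> \<Lambda>' m t A) \<le> c"
  shows "var_div \<alpha> \<Lambda> \<Lambda>' \<le> c"
  unfolding var_div_def using assms by (intro Sup_least) auto

text \<open>Negative summands are truncated to 0 on the right, whereas on the left they still cancel
  against positive ones.\<close>

lemma ennreal_sum_le: "ennreal (\<Sum>k\<in>I. f k) \<le> (\<Sum>k\<in>I. ennreal (f k))"
proof (induction I rule: infinite_finite_induct)
  case (insert x F)
  have "ennreal (f x + (\<Sum>k\<in>F. f k)) \<le> ennreal (f x) + ennreal (\<Sum>k\<in>F. f k)"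
    by (cases "0 \<le> f x"; cases "0 \<le> (\<Sum>k\<in>F. f k)")
      (auto simp: ennreal_neg intro!: ennreal_leI)
  also have "\<dots> \<le> ennreal (f x) + (\<Sum>k\<in>F. ennreal (f k))" using insert by (intro add_left_mono)
  finally show ?case using insert by simp
qed auto

lemma var_val_le_sum_tsallis_fun:
  assumes "0 < \<alpha>" "\<alpha> \<noteq> 1" "\<And>k. t k > 0"
  shows "ennreal (var_val \<alpha> \<Lambda> \<Lambda>' m t A) \<le> (\<Sum>k<m. tsallis_fun \<alpha> (measure \<Lambda> (A k)) (measure \<Lambda>' (A k)))"
  unfolding var_val_def using assms
  by (intro order_trans[OF ennreal_sum_le] sum_mono tangent_le_tsallis_fun) auto

lemma sum_tsallis_fun_le_integral:
  assumes dens: "has_density \<nu> \<Lambda> f" "has_density \<nu> \<Lambda>' g"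
    and \<alpha>: "0 < \<alpha>" "\<alpha> \<noteq> 1"
    and A: "fin_family \<Lambda> \<Lambda>' m A"
  shows "(\<Sum>k<m. tsallis_fun \<alpha> (measure \<Lambda> (A k)) (measure \<Lambda>' (A k))) \<le> (\<integral>\<^sup>+x. tsallis_fun \<alpha> (f x) (g x) \<partial>\<nu>)"
proof -
  have A': "A k \<in> sets \<nu>" "emeasure \<Lambda> (A k) < \<infinity>" "emeasure \<Lambda>' (A k) < \<infinity>" if "k < m" for k
    using A that has_density_sets[OF dens(1)] by (auto simp: fin_family_def)
  have dj: "disjoint_family_on A {..<m}" using A by (simp add: fin_family_def)
  note [measurable] = has_density_measurable[OF dens(1)] has_density_measurable[OF dens(2)] A'(1)
  have "(\<Sum>k<m. tsallis_fun \<alpha> (measure \<Lambda> (A k)) (measure \<Lambda>' (A k))) \<le>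
    (\<Sum>k<m. \<integral>\<^sup>+x. tsallis_fun \<alpha> (f x) (g x) * indicator (A k) x \<partial>\<nu>)"
    by (intro sum_mono tsallis_fun_measure_le dens \<alpha> A') auto
  also have "\<dots> = (\<integral>\<^sup>+x. (\<Sum>k<m. tsallis_fun \<alpha> (f x) (g x) * indicator (A k) x) \<partial>\<nu>)"
    by (intro nn_integral_sum[symmetric]) auto
  also have "\<dots> = (\<integral>\<^sup>+x. tsallis_fun \<alpha> (f x) (g x) * indicator (\<Union>k<m. A k) x \<partial>\<nu>)"
    using dj by (intro nn_integral_cong) (simp add: indicator_UN_disjoint flip: sum_distrib_left)
  also have "\<dots> \<le> (\<integral>\<^sup>+x. tsallis_fun \<alpha> (f x) (g x) \<partial>\<nu>)"
    by (intro nn_integral_mono) (auto simp: indicator_def)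
  finally show ?thesis .
qed

text \<open>One direction is Jensen's inequality on each piece. For the other the integrand is
  exhausted by maxima of finitely many tangents on sets where everything is finite. Splitting such a
  set according to which tangent attains the maximum turns the integral into an exact value of
  \<open>var_val\<close>.\<close>

lemma integral_eq_var_div:
  assumes \<nu>: "sigma_finite_measure \<nu>" and dens: "has_density \<nu> \<Lambda> f" "has_density \<nu> \<Lambda>' g"
    and \<alpha>: "0 < \<alpha>" "\<alpha> \<noteq> 1"
  shows "(\<integral>\<^sup>+x. tsallis_fun \<alpha> (f x) (g x) \<partial>\<nu>) = var_div \<alpha> \<Lambda> \<Lambda>'"
proof (rule antisym)
  show "var_div \<alpha> \<Lambda> \<Lambda>' \<le> (\<integral>\<^sup>+x. tsallis_fun \<alpha> (f x) (g x) \<partial>\<nu>)"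
    using order_trans[OF var_val_le_sum_tsallis_fun[OF \<alpha>] sum_tsallis_fun_le_integral[OF dens \<alpha>]]
    by (intro var_div_least) auto
next
  interpret sigma_finite_measure \<nu> by fact
  note f[measurable] = has_density_measurable[OF dens(1)]
  note g[measurable] = has_density_measurable[OF dens(2)]
  note nn = has_density_nonneg[OF dens(1)] has_density_nonneg[OF dens(2)]
  obtain C :: "nat \<Rightarrow> 'a set" where C: "range C \<subseteq> sets \<nu>" "(\<Union>i. C i) = space \<nu>"
    "\<And>i. emeasure \<nu> (C i) \<noteq> \<infinity>" "incseq C"
    using sigma_finite_incseq by metis
  have [measurable]: "C n \<in> sets \<nu>" for n using C by auto
  \<comment> \<open>Bounded densities on a set of finite \<nu>-mass: every measurable subset has
    finite mass under \<Lambda> and \<Lambda>'.\<close>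
  define E where "E N = {x \<in> C N. f x \<le> real N \<and> g x \<le> real N}" for N
  have CE: "E N = {x \<in> space \<nu>. x \<in> C N \<and> f x \<le> real N \<and> g x \<le> real N}" for N
    using C(2) by (auto simp: E_def)
  have E[measurable]: "E N \<in> sets \<nu>" for N unfolding CE by measurable
  have incE: "E N \<subseteq> E N'" if "N \<le> N'" for N N'
    using that monoD[OF C(4) that] by (fastforce simp: E_def)
  have finE: "emeasure \<Lambda> A < \<infinity>" "emeasure \<Lambda>' A < \<infinity>" if "A \<subseteq> E N" "A \<in> sets \<nu>" for A N
  proof -
    have *: "(\<integral>\<^sup>+x. ennreal (h x) * indicator A x \<partial>\<nu>) < \<infinity>" if "\<And>x. x \<in> A \<Longrightarrow> h x \<le> real N" for h
    proof -
      have "(\<integral>\<^sup>+x. ennreal (h x) * indicator A x \<partial>\<nu>) \<le> (\<integral>\<^sup>+x. ennreal (real N) * indicator (C N) x \<partial>\<nu>)"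
        using that \<open>A \<subseteq> E N\<close> by (intro nn_integral_mono) (auto simp: indicator_def E_def intro!: ennreal_leI)
      also have "\<dots> = ennreal (real N) * emeasure \<nu> (C N)" by (simp add: nn_integral_cmult_indicator)
      also have "\<dots> < \<infinity>" using C(3)[of N] by (simp add: ennreal_mult_less_top less_top)
      finally show ?thesis .
    qed
    show "emeasure \<Lambda> A < \<infinity>" "emeasure \<Lambda>' A < \<infinity>"
      unfolding has_density_emeasure[OF dens(1) that(2)] has_density_emeasure[OF dens(2) that(2)]
      using that(1) by (intro *; force simp: E_def)+
  qed
  define l where "l k x = tangent \<alpha> (pos_rat k) (f x) (g x)" for k x
  have [measurable]: "l k \<in> borel_measurable \<nu>" for k unfolding l_def[abs_def] by measurable
  \<comment> \<open>Both the maximum and the set increase with N, so monotone convergence applies,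
    and each \<psi> N is linear in the densities on finitely many pieces.\<close>
  define \<psi> where "\<psi> N x = ennreal (Max ((\<lambda>k. l k x) ` {..N})) * indicator (E N) x" for N x
  have "(\<integral>\<^sup>+x. tsallis_fun \<alpha> (f x) (g x) \<partial>\<nu>) = (\<integral>\<^sup>+x. (SUP N. \<psi> N x) \<partial>\<nu>)"
  proof (rule nn_integral_cong, rule antisym)
    fix x assume x: "x \<in> space \<nu>"
    have "ennreal (l k x) \<le> (SUP N. \<psi> N x)" for k
    proof -
      obtain i where i: "x \<in> C i" using C(2) x by auto
      obtain j where j: "real j \<ge> max (f x) (g x)" using real_arch_simple by blast
      let ?N = "max k (max i j)"
      have "C i \<subseteq> C ?N" by (intro monoD[OF C(4)]) linarith
      then have "x \<in> E ?N" using i j by (auto simp: E_def)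
      then have "ennreal (l k x) \<le> \<psi> ?N x" by (auto simp: \<psi>_def intro!: ennreal_leI Max_ge)
      then show ?thesis by (meson SUP_upper2 UNIV_I)
    qed
    then show "tsallis_fun \<alpha> (f x) (g x) \<le> (SUP N. \<psi> N x)"
      by (simp add: tsallis_fun_eq_SUP_tangent[OF \<alpha> nn[OF x]] SUP_least flip: l_def)
    have "\<psi> N x \<le> tsallis_fun \<alpha> (f x) (g x)" for N
    proof -
      have "Max ((\<lambda>k. l k x) ` {..N}) \<in> (\<lambda>k. l k x) ` {..N}" by (intro Max_in) auto
      then obtain k where "Max ((\<lambda>k. l k x) ` {..N}) = l k x" by (elim imageE) blast
      then show ?thesis using tangent_le_tsallis_fun[OF \<alpha> nn[OF x] pos_rat_pos, of k]
        by (auto simp: \<psi>_def l_def indicator_def)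
    qed
    then show "(SUP N. \<psi> N x) \<le> tsallis_fun \<alpha> (f x) (g x)" by (intro SUP_least)
  qed
  also have "\<dots> = (SUP N. integral\<^sup>N \<nu> (\<psi> N))"
  proof (rule nn_integral_monotone_convergence_SUP)
    show "incseq \<psi>"
    proof (intro incseq_SucI le_funI)
      fix N x
      show "\<psi> N x \<le> \<psi> (Suc N) x" using incE[of N "Suc N"]
        by (auto simp: \<psi>_def indicator_def intro!: ennreal_leI Max_mono)
    qed
    have "(\<lambda>x. Max ((\<lambda>k. l k x) ` {..N})) \<in> borel_measurable \<nu>" for N
      by (rule borel_measurable_Max) auto
    then show "\<psi> N \<in> borel_measurable \<nu>" for N unfolding \<psi>_def[abs_def] by measurable
  qed
  also have "\<dots> \<le> var_div \<alpha> \<Lambda> \<Lambda>'"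
  proof (rule SUP_least)
    fix N
    \<comment> \<open>Points at which k is the least index attaining the maximum; taking the least
      one resolves ties and makes the pieces disjoint.\<close>
    define A where "A k = {x \<in> E N. (\<forall>j\<le>N. l j x \<le> l k x) \<and> (\<forall>j<k. l j x < l k x)}" for k
    have AE: "A k \<subseteq> E N" for k by (auto simp: A_def)
    have "A k = {x \<in> space \<nu>. x \<in> E N \<and> (\<forall>j\<le>N. l j x \<le> l k x) \<and> (\<forall>j<k. l j x < l k x)}" for k
      using sets.sets_into_space[OF E] by (auto simp: A_def)
    then have A[measurable]: "A k \<in> sets \<nu>" for k by simp
    have dj: "disjoint_family_on A {..<Suc N}"
    proof -
      have "A i \<inter> A j = {}" if "i < j" "j < Suc N" for i j
      proof (rule equals0I)
        fix x assume "x \<in> A i \<inter> A j"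
        then have "l j x \<le> l i x" "l i x < l j x" using that by (auto simp: A_def)
        then show False by simp
      qed
      then show ?thesis unfolding disjoint_family_on_def
        by (metis Int_commute lessThan_iff linorder_neqE_nat)
    qed
    have fam: "fin_family \<Lambda> \<Lambda>' (Suc N) A"
      using dj finE[OF AE A] A has_density_sets[OF dens(1)] by (simp add: fin_family_def)
    let ?s = "\<lambda>x. \<Sum>k<Suc N. tangent \<alpha> (pos_rat k) (f x * indicator (A k) x) (g x * indicator (A k) x)"
    have s_eq: "ennreal (?s x) = \<psi> N x" "0 \<le> ?s x" if x: "x \<in> space \<nu>" for x
    proof -
      have *: "?s x = (\<Sum>k<Suc N. if x \<in> A k then l k x else 0)"
        by (intro sum.cong) (auto simp: l_def tangent_def)
      have "ennreal (?s x) = \<psi> N x \<and> 0 \<le> ?s x"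
      proof (cases "x \<in> E N")
        case False
        then have "x \<notin> A k" for k using AE by blast
        then show ?thesis unfolding * \<psi>_def using False by simp
      next
        case True
        let ?M = "Max ((\<lambda>k. l k x) ` {..N})"
        define k where "k = (LEAST k. k \<le> N \<and> l k x = ?M)"
        have "?M \<in> (\<lambda>k. l k x) ` {..N}" by (intro Max_in) auto
        then have "\<exists>k. k \<le> N \<and> l k x = ?M" by (elim imageE) (metis atMost_iff)
        then have k: "k \<le> N" "l k x = ?M" unfolding k_def by (rule LeastI2_ex; simp)+
        have le: "l j x \<le> l k x" if "j \<le> N" for j unfolding k(2) using that by (intro Max_ge) auto
        have "l j x \<noteq> l k x" if "j < k" for j
          using not_less_Least[of j "\<lambda>k. k \<le> N \<and> l k x = ?M"] that k by (auto simp flip: k_def)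
        with le have xk: "x \<in> A k" using True k(1) by (fastforce simp: A_def less_le)
        have "x \<notin> A j" if "j < Suc N" "j \<noteq> k" for j
          using disjoint_family_onD[OF dj, of j k] xk that k(1) by auto
        then have "?s x = (\<Sum>j<Suc N. if j = k then l k x else 0)"
          unfolding * using xk by (intro sum.cong) auto
        then have "?s x = l k x" using k(1) by simp
        \<comment> \<open>Index 0 carries the parameter 1, whose tangent is identically 0, so the
          maximum is never negative and the truncation of \<open>ennreal\<close> has no
          effect.\<close>
        moreover have "0 \<le> l k x" using le[of 0] by (simp add: l_def pos_rat_0 tangent_def)
        ultimately show ?thesis using True k(2) by (simp add: \<psi>_def)
      qed
      then show "ennreal (?s x) = \<psi> N x" "0 \<le> ?s x" by auto
    qed
    have int: "integrable \<nu> (\<lambda>x. f x * indicator (A k) x)" "integrable \<nu> (\<lambda>x. g x * indicator (A k) x)"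
      "(\<integral>x. f x * indicator (A k) x \<partial>\<nu>) = measure \<Lambda> (A k)" "(\<integral>x. g x * indicator (A k) x \<partial>\<nu>) = measure \<Lambda>' (A k)" for k
      using has_density_integral[OF dens(1) A finE(1)[OF AE A]] has_density_integral[OF dens(2) A finE(2)[OF AE A]] by auto
    have int': "integrable \<nu> (\<lambda>x. tangent \<alpha> (pos_rat k) (f x * indicator (A k) x) (g x * indicator (A k) x))"
      "(\<integral>x. tangent \<alpha> (pos_rat k) (f x * indicator (A k) x) (g x * indicator (A k) x) \<partial>\<nu>) =
        tangent \<alpha> (pos_rat k) (measure \<Lambda> (A k)) (measure \<Lambda>' (A k))" for k
      using int unfolding tangent_def by simp_all
    have "integral\<^sup>N \<nu> (\<psi> N) = (\<integral>\<^sup>+x. ennreal (?s x) \<partial>\<nu>)"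
      by (intro nn_integral_cong) (simp add: s_eq del: sum.lessThan_Suc)
    also have "\<dots> = ennreal (\<integral>x. ?s x \<partial>\<nu>)"
      using int' s_eq(2) by (intro nn_integral_eq_integral Bochner_Integration.integrable_sum AE_I2) (auto simp del: sum.lessThan_Suc)
    also have "(\<integral>x. ?s x \<partial>\<nu>) = var_val \<alpha> \<Lambda> \<Lambda>' (Suc N) pos_rat A"
      unfolding var_val_def using int' by (simp del: sum.lessThan_Suc)
    also have "ennreal \<dots> \<le> var_div \<alpha> \<Lambda> \<Lambda>'"
      by (intro var_val_le_var_div fam pos_rat_pos)
    finally show "integral\<^sup>N \<nu> (\<psi> N) \<le> var_div \<alpha> \<Lambda> \<Lambda>'" .
  qed
  finally show "(\<integral>\<^sup>+x. tsallis_fun \<alpha> (f x) (g x) \<partial>\<nu>) \<le> var_div \<alpha> \<Lambda> \<Lambda>'" .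
qed


section \<open>Hellinger integrals and the Renyi divergence\<close>

definition hellinger_fun :: "real \<Rightarrow> real \<Rightarrow> real \<Rightarrow> ennreal" where
  "hellinger_fun \<alpha> p q = e2ennreal (powr_prod \<alpha> p q)"

lemma hellinger_fun_measurable [measurable]:
  assumes [measurable]: "f \<in> borel_measurable \<nu>" "g \<in> borel_measurable \<nu>"
  shows "(\<lambda>x. hellinger_fun \<alpha> (f x) (g x)) \<in> borel_measurable \<nu>"
  unfolding hellinger_fun_def by measurable

lemma hellinger_fun_real:
  assumes "\<alpha> \<le> 1 \<or> q > 0" "0 \<le> q"
  shows "hellinger_fun \<alpha> p q = ennreal (p powr \<alpha> * q powr (1 - \<alpha>))"
  using assms powr_minus_divide[of q "\<alpha> - 1"]
  by (auto simp: hellinger_fun_def powr_prod_def)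

lemma hellinger_fun_top: "\<alpha> > 1 \<Longrightarrow> p \<noteq> 0 \<Longrightarrow> hellinger_fun \<alpha> p 0 = \<top>"
  by (simp add: hellinger_fun_def powr_prod_def)

lemma hellinger_fun_0_0: "hellinger_fun \<alpha> 0 0 = 0"
  by (simp add: hellinger_fun_def powr_prod_def flip: zero_ereal_def)

text \<open>The conventions 0/0 = 0 and t/0 = \<infinity> agree with 0 * \<infinity> = 0 in
  \<open>ennreal\<close>. Above order one with a zero denominator, both sides are 0 if a numerator
  vanishes, and otherwise infinite, as the remaining factor cannot be 0.\<close>

lemma hellinger_fun_mult:
  assumes "0 \<le> a" "0 \<le> b" "0 \<le> c" "0 \<le> d"
  shows "hellinger_fun \<alpha> (a * c) (b * d) = hellinger_fun \<alpha> a b * hellinger_fun \<alpha> c d"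
proof -
  have gen: ?thesis if "\<alpha> \<le> 1 \<or> (b > 0 \<and> d > 0)"
    using assms that by (auto simp: hellinger_fun_real powr_mult mult_ac simp flip: ennreal_mult)
  have pos: "hellinger_fun \<alpha> x y \<noteq> 0" if "\<alpha> > 1" "x > 0" "y \<ge> 0" for x y
    using that hellinger_fun_top[of \<alpha> x]
    by (cases "y = 0") (auto simp: hellinger_fun_real)
  have zero: "hellinger_fun \<alpha> 0 y = 0" if "y \<ge> 0" for y
    using that by (cases "y = 0") (auto simp: hellinger_fun_real hellinger_fun_0_0)
  show ?thesis
  proof (cases "\<alpha> \<le> 1 \<or> (b > 0 \<and> d > 0)")
    case False
    then have *: "\<alpha> > 1" "b = 0 \<or> d = 0" using assms by auto
    show ?thesis
    proof (cases "a = 0 \<or> c = 0")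
      case True then show ?thesis using zero[of b] zero[of d] zero[of "b * d"] assms by auto
    next
      case False
      then show ?thesis using * pos[of a b] pos[of c d] assms
        by (auto simp: hellinger_fun_top ennreal_top_mult ennreal_mult_top)
    qed
  qed (rule gen)
qed

lemma hellinger_fun_prod:
  assumes "finite I" "\<And>i. i \<in> I \<Longrightarrow> 0 \<le> f i" "\<And>i. i \<in> I \<Longrightarrow> 0 \<le> g i"
  shows "hellinger_fun \<alpha> (\<Prod>i\<in>I. f i) (\<Prod>i\<in>I. g i) = (\<Prod>i\<in>I. hellinger_fun \<alpha> (f i) (g i))"
  using assms
  by (induction I) (auto simp: hellinger_fun_real hellinger_fun_mult prod_nonneg)

lemma hellinger_fun_power:
  "0 \<le> a \<Longrightarrow> 0 \<le> b \<Longrightarrow> hellinger_fun \<alpha> (a ^ k) (b ^ k) = hellinger_fun \<alpha> a b ^ k"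
  by (induction k) (auto simp: hellinger_fun_real hellinger_fun_mult)

text \<open>Stated as an equation of sums because subtraction in \<open>ennreal\<close> is
  truncated. For probability densities the right-hand side integrates to 1.\<close>

lemma tsallis_hellinger_less:
  assumes "0 < \<alpha>" "\<alpha> < 1" "0 \<le> a" "0 \<le> b"
  shows "ennreal (1 - \<alpha>) * tsallis_fun \<alpha> a b + hellinger_fun \<alpha> a b = ennreal \<alpha> * ennreal a + ennreal (1 - \<alpha>) * ennreal b"
proof -
  have "0 \<le> \<alpha> * a + (1 - \<alpha>) * b - a powr \<alpha> * b powr (1 - \<alpha>)"
    using Young_powr[OF assms] by simp
  then show ?thesis using assms
    by (simp add: tsallis_fun_real hellinger_fun_real flip: ennreal_mult ennreal_plus)
qed

text \<open>Above order one 1 - \<alpha> is negative, so the terms change sides to keep every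
  coefficient nonnegative. This form also holds for b = 0 < a, where both sides are
  infinite.\<close>

lemma tsallis_hellinger_greater:
  assumes "1 < \<alpha>" "0 \<le> a" "0 \<le> b"
  shows "ennreal (\<alpha> - 1) * tsallis_fun \<alpha> a b + ennreal \<alpha> * ennreal a = hellinger_fun \<alpha> a b + ennreal (\<alpha> - 1) * ennreal b"
proof (cases "b = 0")
  case True
  then show ?thesis using assms
    by (cases "a = 0") (auto simp: tsallis_fun_top hellinger_fun_top tsallis_fun_0_0 hellinger_fun_0_0 ennreal_mult_top)
next
  case False
  have "(\<alpha> - 1) * ((\<alpha> * a + (1 - \<alpha>) * b - a powr \<alpha> * b powr (1 - \<alpha>)) / (1 - \<alpha>)) =
    a powr \<alpha> * b powr (1 - \<alpha>) + (\<alpha> - 1) * b - \<alpha> * a" using assms by (simp add: field_simps)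
  moreover have "0 \<le> (\<alpha> - 1) * ((\<alpha> * a + (1 - \<alpha>) * b - a powr \<alpha> * b powr (1 - \<alpha>)) / (1 - \<alpha>))"
    using assms False tsallis_fun_nonneg_real[of \<alpha> b a] by (intro mult_nonneg_nonneg) auto
  ultimately show ?thesis using assms False tsallis_fun_nonneg_real[of \<alpha> b a]
    by (simp add: tsallis_fun_real hellinger_fun_real flip: ennreal_mult ennreal_plus)
qed

lemma has_density_nn_integral:
  assumes "has_density m P p" "prob_space P"
  shows "(\<integral>\<^sup>+x. ennreal (p x) \<partial>m) = 1"
proof -
  interpret prob_space P by fact
  have "space P = space m" using assms(1) by (simp add: has_density_def)
  then have "1 = emeasure P (space m)" using emeasure_space_1 by simp
  also have "\<dots> = (\<integral>\<^sup>+x. ennreal (p x) * indicator (space m) x \<partial>m)"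
    by (rule has_density_emeasure[OF assms(1)]) simp
  also have "\<dots> = (\<integral>\<^sup>+x. ennreal (p x) \<partial>m)" by (intro nn_integral_cong) simp
  finally show ?thesis by simp
qed

lemma tsallis_hellinger_integral_less:
  assumes "0 < \<alpha>" "\<alpha> < 1" and dens: "has_density m P p" "has_density m Q q" and prob: "prob_space P" "prob_space Q"
  shows "ennreal (1 - \<alpha>) * (\<integral>\<^sup>+x. tsallis_fun \<alpha> (p x) (q x) \<partial>m) + (\<integral>\<^sup>+x. hellinger_fun \<alpha> (p x) (q x) \<partial>m) = 1"
proof -
  note [measurable] = has_density_measurable[OF dens(1)] has_density_measurable[OF dens(2)]
  have "ennreal (1 - \<alpha>) * (\<integral>\<^sup>+x. tsallis_fun \<alpha> (p x) (q x) \<partial>m) + (\<integral>\<^sup>+x. hellinger_fun \<alpha> (p x) (q x) \<partial>m) =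
    (\<integral>\<^sup>+x. ennreal (1 - \<alpha>) * tsallis_fun \<alpha> (p x) (q x) + hellinger_fun \<alpha> (p x) (q x) \<partial>m)"
    by (simp add: nn_integral_add nn_integral_cmult)
  also have "\<dots> = (\<integral>\<^sup>+x. ennreal \<alpha> * ennreal (p x) + ennreal (1 - \<alpha>) * ennreal (q x) \<partial>m)"
    using assms(1,2) has_density_nonneg[OF dens(1)] has_density_nonneg[OF dens(2)]
    by (intro nn_integral_cong tsallis_hellinger_less) auto
  also have "\<dots> = ennreal \<alpha> * 1 + ennreal (1 - \<alpha>) * 1"
    by (simp add: nn_integral_add nn_integral_cmult has_density_nn_integral[OF dens(1) prob(1)] has_density_nn_integral[OF dens(2) prob(2)])
  also have "\<dots> = 1" using assms(1,2) by (simp flip: ennreal_plus)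
  finally show ?thesis .
qed

lemma tsallis_hellinger_integral_greater:
  assumes "1 < \<alpha>" and dens: "has_density m P p" "has_density m Q q" and prob: "prob_space P" "prob_space Q"
  shows "ennreal (\<alpha> - 1) * (\<integral>\<^sup>+x. tsallis_fun \<alpha> (p x) (q x) \<partial>m) + 1 = (\<integral>\<^sup>+x. hellinger_fun \<alpha> (p x) (q x) \<partial>m)"
proof -
  note [measurable] = has_density_measurable[OF dens(1)] has_density_measurable[OF dens(2)]
  let ?D = "ennreal (\<alpha> - 1) * (\<integral>\<^sup>+x. tsallis_fun \<alpha> (p x) (q x) \<partial>m)" and ?H = "(\<integral>\<^sup>+x. hellinger_fun \<alpha> (p x) (q x) \<partial>m)"
  have "?D + ennreal \<alpha> * (\<integral>\<^sup>+x. ennreal (p x) \<partial>m) =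
    (\<integral>\<^sup>+x. ennreal (\<alpha> - 1) * tsallis_fun \<alpha> (p x) (q x) + ennreal \<alpha> * ennreal (p x) \<partial>m)"
    by (simp add: nn_integral_add nn_integral_cmult)
  also have "\<dots> = (\<integral>\<^sup>+x. hellinger_fun \<alpha> (p x) (q x) + ennreal (\<alpha> - 1) * ennreal (q x) \<partial>m)"
    using assms(1) has_density_nonneg[OF dens(1)] has_density_nonneg[OF dens(2)]
    by (intro nn_integral_cong tsallis_hellinger_greater) auto
  also have "\<dots> = ?H + ennreal (\<alpha> - 1) * (\<integral>\<^sup>+x. ennreal (q x) \<partial>m)"
    by (simp add: nn_integral_add nn_integral_cmult)
  finally have "?D + ennreal \<alpha> = ?H + ennreal (\<alpha> - 1)"
    by (simp add: has_density_nn_integral[OF dens(1) prob(1)] has_density_nn_integral[OF dens(2) prob(2)])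
  moreover have "ennreal \<alpha> = 1 + ennreal (\<alpha> - 1)" using assms(1)
    by (simp flip: ennreal_plus ennreal_1)
  ultimately have "ennreal (\<alpha> - 1) + (?D + 1) = ennreal (\<alpha> - 1) + ?H" by (simp add: ac_simps)
  then show ?thesis by (simp add: ennreal_add_left_cancel)
qed

text \<open>With \<open>x\<close> the Renyi divergence of two probability measures, \<open>exp_div \<alpha> x\<close> is their Hellinger
  integral and \<open>power_div \<alpha> x\<close> their Tsallis divergence, which \<open>renyi_of_power\<close> converts back.\<close>

definition exp_div :: "real \<Rightarrow> ennreal \<Rightarrow> ennreal" where
  "exp_div \<alpha> x = (if x = \<top> then if \<alpha> < 1 then 0 else \<top> else ennreal (exp ((\<alpha> - 1) * enn2real x)))"

definition power_div :: "real \<Rightarrow> ennreal \<Rightarrow> ennreal" where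
  "power_div \<alpha> x = (if x = \<top> then if \<alpha> < 1 then ennreal (1 / (1 - \<alpha>)) else \<top>
     else ennreal ((exp ((\<alpha> - 1) * enn2real x) - 1) / (\<alpha> - 1)))"

definition renyi_of_power :: "real \<Rightarrow> ennreal \<Rightarrow> ereal" where
  "renyi_of_power \<alpha> d = (if \<alpha> = 1 then enn2ereal d else if d = \<top> then \<infinity>
     else ereal (1 / (\<alpha> - 1)) * ext_ln (ereal (1 + (\<alpha> - 1) * enn2real d)))"

lemma exp_div_0 [simp]: "exp_div \<alpha> 0 = 1"
  by (simp add: exp_div_def)

lemma exp_div_add: "exp_div \<alpha> (x + y) = exp_div \<alpha> x * exp_div \<alpha> y"
  by (auto simp: exp_div_def enn2real_plus less_top ennreal_top_mult ennreal_mult_top distrib_left exp_add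
      simp flip: ennreal_mult)

lemma exp_div_sum: "exp_div \<alpha> (\<Sum>i\<in>I. x i) = (\<Prod>i\<in>I. exp_div \<alpha> (x i))"
  by (induction I rule: infinite_finite_induct) (auto simp: exp_div_add)

lemma power_div_real_nonneg:
  fixes \<alpha> r :: real
  assumes "\<alpha> \<noteq> 1" "0 \<le> r"
  shows "0 \<le> (exp ((\<alpha> - 1) * r) - 1) / (\<alpha> - 1)"
proof (cases "\<alpha> < 1")
  case True
  then have "(\<alpha> - 1) * r \<le> 0" using assms by (simp add: mult_nonpos_nonneg)
  then show ?thesis using True by (intro divide_nonpos_nonpos) auto
qed (use assms in auto)

text \<open>The total 1 forces d and the Hellinger integral to be finite, so the equation can be
  solved in the reals.\<close>

lemma power_div_unique_less:
  assumes "0 < \<alpha>" "\<alpha> < 1" "ennreal (1 - \<alpha>) * d + exp_div \<alpha> x = 1"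
  shows "d = power_div \<alpha> x"
proof -
  have fin: "d \<noteq> \<top>" using assms by (auto simp: ennreal_mult_top)
  then obtain r where r: "d = ennreal r" "0 \<le> r" by (cases d) auto
  obtain e where e: "exp_div \<alpha> x = ennreal e" "0 \<le> e" "e = (if x = \<top> then 0 else exp ((\<alpha> - 1) * enn2real x))"
    using assms by (auto simp: exp_div_def)
  have "ennreal ((1 - \<alpha>) * r + e) = ennreal 1"
    using assms r e(1,2) by (simp add: ennreal_mult)
  then have "(1 - \<alpha>) * r + e = 1" using r e(2) assms by (subst (asm) ennreal_inj) auto
  then have "r = (1 - e) / (1 - \<alpha>)" using assms by (simp add: field_simps)
  also have "\<dots> = (e - 1) / (\<alpha> - 1)" by (metis minus_diff_eq minus_divide_divide)
  finally show ?thesis using assms r e(3) by (auto simp: power_div_def minus_divide_divide[of 1 "1 - \<alpha>", symmetric])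
qed

lemma power_div_unique_greater:
  assumes "1 < \<alpha>" "ennreal (\<alpha> - 1) * d + 1 = exp_div \<alpha> x"
  shows "d = power_div \<alpha> x"
proof (cases "x = \<top>")
  case True
  then have "ennreal (\<alpha> - 1) * d = \<top>" using assms by (simp add: exp_div_def)
  then show ?thesis using True assms by (auto simp: power_div_def ennreal_mult_eq_top_iff)
next
  case False
  then have "ennreal (\<alpha> - 1) * d + 1 \<noteq> \<top>" using assms by (simp add: exp_div_def)
  then have "d \<noteq> \<top>" using assms(1) by (auto simp: ennreal_mult_top)
  then obtain r where r: "d = ennreal r" "0 \<le> r" by (cases d) auto
  have "ennreal ((\<alpha> - 1) * r + 1) = ennreal (exp ((\<alpha> - 1) * enn2real x))"
    using assms r False by (simp add: ennreal_mult exp_div_def)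
  then have "(\<alpha> - 1) * r + 1 = exp ((\<alpha> - 1) * enn2real x)" using r assms by (subst (asm) ennreal_inj) auto
  then have "r = (exp ((\<alpha> - 1) * enn2real x) - 1) / (\<alpha> - 1)" using assms by (simp add: field_simps)
  then show ?thesis using r False by (simp add: power_div_def)
qed

lemma power_div_mono:
  assumes "\<alpha> \<noteq> 1" "x \<le> y" shows "power_div \<alpha> x \<le> power_div \<alpha> y"
proof (cases "x = \<top>")
  case True then show ?thesis using assms by (simp add: top_unique)
next
  case x: False
  let ?e = "\<lambda>x. (exp ((\<alpha> - 1) * enn2real x) - 1) / (\<alpha> - 1)"
  show ?thesis
  proof (cases "y = \<top>")
    case True
    have "?e x \<le> 1 / (1 - \<alpha>)" if "\<alpha> < 1"
    proof -
      have "?e x = (1 - exp ((\<alpha> - 1) * enn2real x)) / (1 - \<alpha>)" by (metis minus_diff_eq minus_divide_divide)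
      also have "\<dots> \<le> 1 / (1 - \<alpha>)" using that by (intro divide_right_mono) auto
      finally show ?thesis .
    qed
    then show ?thesis using x True by (auto simp: power_div_def intro!: ennreal_leI)
  next
    case False
    have le: "enn2real x \<le> enn2real y" using assms False by (intro enn2real_mono) (auto simp: less_top)
    have "?e x \<le> ?e y"
    proof (cases "\<alpha> < 1")
      case True
      then show ?thesis using le by (intro divide_right_mono_neg) (auto simp: mult_left_mono_neg)
    next
      case False
      then show ?thesis using le assms(1) by (intro divide_right_mono) (auto simp: mult_left_mono)
    qed
    then show ?thesis using x False by (auto simp: power_div_def intro!: ennreal_leI)
  qed
qed

lemma renyi_of_power_power_div:
  assumes "0 < \<alpha>" "\<alpha> \<noteq> 1" shows "renyi_of_power \<alpha> (power_div \<alpha> x) = enn2ereal x"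
proof (cases "x = \<top>")
  case True
  \<comment> \<open>Below order one an infinite Renyi divergence appears as the finite Tsallis value
    1 / (1 - \<alpha>), that is, Hellinger integral 0; the logarithm of 0 times a negative factor
    restores infinity.\<close>
  have "(\<alpha> - 1) * (1 / (1 - \<alpha>)) = - 1" if "\<alpha> < 1" using that by (simp add: field_simps)
  moreover have "ereal (1 / (\<alpha> - 1)) * - \<infinity> = \<infinity>" if "\<alpha> < 1" using that by (simp add: ereal_mult_eq_PInfty)
  ultimately show ?thesis using True assms
    by (cases "\<alpha> < 1") (simp_all add: renyi_of_power_def power_div_def ext_ln_def)
next
  case False
  then have "power_div \<alpha> x = ennreal ((exp ((\<alpha> - 1) * enn2real x) - 1) / (\<alpha> - 1))"
    by (simp add: power_div_def)
  moreover have "1 + (\<alpha> - 1) * ((exp ((\<alpha> - 1) * enn2real x) - 1) / (\<alpha> - 1)) = exp ((\<alpha> - 1) * enn2real x)"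
    using assms by simp
  ultimately have "renyi_of_power \<alpha> (power_div \<alpha> x) = ereal (1 / (\<alpha> - 1)) * ext_ln (ereal (exp ((\<alpha> - 1) * enn2real x)))"
    using assms power_div_real_nonneg[OF assms(2), of "enn2real x"] by (simp add: renyi_of_power_def)
  also have "\<dots> = ereal (enn2real x)" using assms by (simp add: ext_ln_def)
  also have "\<dots> = enn2ereal x" using False by (cases x) auto
  finally show ?thesis .
qed

lemma ext_ln_mono: "x \<le> y \<Longrightarrow> ext_ln x \<le> ext_ln y"
  by (cases x; cases y) (auto simp: ext_ln_def)

text \<open>Below order one the argument of the logarithm decreases in the divergence, and the
  negative factor 1 / (\<alpha> - 1) reverses this again.\<close>

lemma renyi_of_power_mono:
  assumes "0 < \<alpha>" "x \<le> y" shows "renyi_of_power \<alpha> x \<le> renyi_of_power \<alpha> y"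
proof (cases "\<alpha> = 1 \<or> y = \<top>")
  case True then show ?thesis using assms by (auto simp: renyi_of_power_def less_eq_ennreal.rep_eq)
next
  case False
  then have x: "x \<noteq> \<top>" using assms by (auto simp: top_unique)
  have le: "enn2real x \<le> enn2real y" using assms False by (intro enn2real_mono) (auto simp: less_top)
  show ?thesis
  proof (cases "\<alpha> < 1")
    case True
    then have "ext_ln (ereal (1 + (\<alpha> - 1) * enn2real y)) \<le> ext_ln (ereal (1 + (\<alpha> - 1) * enn2real x))"
      using le by (intro ext_ln_mono) (auto simp: mult_left_mono_neg)
    then have "ereal (1 / (\<alpha> - 1)) * ext_ln (ereal (1 + (\<alpha> - 1) * enn2real x)) \<le> ereal (1 / (\<alpha> - 1)) * ext_ln (ereal (1 + (\<alpha> - 1) * enn2real y))"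
      using True
      by (cases "ext_ln (ereal (1 + (\<alpha> - 1) * enn2real x))"; cases "ext_ln (ereal (1 + (\<alpha> - 1) * enn2real y))")
        (auto simp: divide_right_mono_neg)
    then show ?thesis using x False by (simp add: renyi_of_power_def)
  next
    case g: False
    then have "ext_ln (ereal (1 + (\<alpha> - 1) * enn2real x)) \<le> ext_ln (ereal (1 + (\<alpha> - 1) * enn2real y))"
      using le by (intro ext_ln_mono) (auto simp: mult_left_mono)
    then have "ereal (1 / (\<alpha> - 1)) * ext_ln (ereal (1 + (\<alpha> - 1) * enn2real x)) \<le> ereal (1 / (\<alpha> - 1)) * ext_ln (ereal (1 + (\<alpha> - 1) * enn2real y))"
      using g by (intro ereal_mult_left_mono) auto
    then show ?thesis using x False by (simp add: renyi_of_power_def)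
  qed
qed


section \<open>Products of Poisson laws\<close>

text \<open>The density of a Poisson law with respect to the one of mean \<open>1\<close>. With a natural exponent
  (so \<open>0 ^ 0 = 1\<close>), it is correct for \<open>a = 0\<close> as well.\<close>

definition poisson_density :: "real \<Rightarrow> ennreal \<Rightarrow> real" where
  "poisson_density a x = exp (1 - a) * a ^ nat \<lfloor>enn2real x\<rfloor>"

lemma poisson_density_measurable [measurable]: "poisson_density a \<in> borel_measurable borel"
proof -
  have "(\<lambda>x::ennreal. \<lfloor>enn2real x\<rfloor>) \<in> borel \<rightarrow>\<^sub>M count_space UNIV" by measurable
  moreover have "(\<lambda>k. exp (1 - a) * a ^ nat k) \<in> count_space UNIV \<rightarrow>\<^sub>M borel" by simp
  ultimately show ?thesis
    unfolding poisson_density_def[abs_def] by (rule measurable_compose)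
qed

lemma poisson_density_of_nat: "poisson_density a (of_nat k) = exp (1 - a) * a ^ k"
  by (simp add: poisson_density_def)

lemma poisson_density_nonneg: "0 \<le> a \<Longrightarrow> 0 \<le> poisson_density a x"
  by (simp add: poisson_density_def)

lemma poisson_law_1: "poisson_law 1 = distr (measure_pmf (poisson_pmf 1)) borel of_nat"
  by (simp add: poisson_law_def)

lemma sets_poisson_law [simp]: "sets (poisson_law r) = sets borel"
  by (simp add: poisson_law_def)

lemma space_poisson_law [simp]: "space (poisson_law r) = UNIV"
  by (simp add: poisson_law_def)

lemma prob_space_poisson_law: "prob_space (poisson_law r)"
  by (auto simp: poisson_law_def intro!: prob_space_return measure_pmf.prob_space_distr)

lemma nn_integral_poisson_law_1:
  assumes [measurable]: "h \<in> borel_measurable borel"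
  shows "(\<integral>\<^sup>+x. h x \<partial>poisson_law 1) = (\<Sum>k. ennreal (exp (- 1) / fact k) * h (of_nat k))"
  by (simp add: poisson_law_1 nn_integral_distr nn_integral_measure_pmf nn_integral_count_space_nat mult_ac)

text \<open>The factor exp (1 - a) * a ^ k is the quotient of the weights exp (-a) a^k / k! and exp
  (-1) / k!. The law of mean 1 charges every count and so dominates all Poisson laws of finite
  mean.\<close>

lemma poisson_law_eq_density:
  assumes a: "0 \<le> a"
  shows "poisson_law (ennreal a) = density (poisson_law 1) (\<lambda>x. ennreal (poisson_density a x))"
proof -
  \<comment> \<open>The comparison takes place on the natural numbers and is then pushed forward
    along \<open>of_nat\<close>.\<close>
  define D where "D = density (measure_pmf (poisson_pmf 1)) (\<lambda>k. ennreal (exp (1 - a) * a ^ k))"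
  have emD: "emeasure D A = (\<integral>\<^sup>+k. ennreal (exp (- a) * a ^ k / fact k) * indicator A k \<partial>count_space UNIV)" for A
    unfolding D_def
    by (auto simp: emeasure_density nn_integral_measure_pmf exp_diff exp_minus field_simps a simp flip: ennreal_mult mult.assoc intro!: nn_integral_cong)
  have D: "density (poisson_law 1) (\<lambda>x. ennreal (poisson_density a x)) = distr D borel of_nat"
    unfolding poisson_law_1 D_def by (subst density_distr) (simp_all add: poisson_density_of_nat)
  show ?thesis
  proof (cases "a = 0")
    \<comment> \<open>Mean 0 is a separate clause of \<open>poisson_law\<close>; here 0 ^ 0 = 1
      leaves only the count 0, with total weight exp 1 * exp (-1) = 1.\<close>
    case True
    have "D = return (count_space UNIV) 0"
    proof (rule measure_eqI)
      fix A assume "A \<in> sets D"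
      have "emeasure D A = (\<integral>\<^sup>+k. indicator A (0::nat) * indicator {0::nat} k \<partial>count_space UNIV)"
        unfolding emD by (intro nn_integral_cong) (auto simp: indicator_def True)
      also have "\<dots> = indicator A 0" by (simp add: nn_integral_cmult_indicator)
      finally show "emeasure D A = emeasure (return (count_space UNIV) 0) A" by simp
    qed (simp add: D_def)
    then show ?thesis unfolding D using True by (simp add: poisson_law_def distr_return)
  next
    case False
    then have pos: "a > 0" using a by simp
    have "D = measure_pmf (poisson_pmf a)"
    proof (rule measure_eqI)
      fix A assume "A \<in> sets D"
      have "emeasure (measure_pmf (poisson_pmf a)) A = (\<integral>\<^sup>+k. indicator A k \<partial>measure_pmf (poisson_pmf a))" by simp
      also have "\<dots> = emeasure D A" unfolding emD using pos
        by (auto simp: nn_integral_measure_pmf mult_ac intro!: nn_integral_cong simp del: nn_integral_indicator nn_integral_indicator')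
      finally show "emeasure D A = emeasure (measure_pmf (poisson_pmf a)) A" by simp
    qed (simp add: D_def)
    then show ?thesis unfolding D using False a by (simp add: poisson_law_def)
  qed
qed

text \<open>With h = a^\<alpha> b^(1-\<alpha>) the integral is an exponential series in h and sums
  to exp (h - \<alpha> a - (1 - \<alpha>) b). Its exponent is (\<alpha> - 1) times the Tsallis
  integrand: this computation is why Renyi on the level of laws becomes Tsallis on the level of
  intensities.\<close>

lemma hellinger_poisson:
  assumes \<alpha>: "0 < \<alpha>" "\<alpha> \<noteq> 1" and ab: "0 \<le> a" "0 \<le> b"
  shows "(\<integral>\<^sup>+x. hellinger_fun \<alpha> (poisson_density a x) (poisson_density b x) \<partial>poisson_law 1) =
    exp_div \<alpha> (tsallis_fun \<alpha> a b)"
proof -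
  let ?c = "exp (\<alpha> * (1 - a) + (1 - \<alpha>) * (1 - b))"
  have c: "hellinger_fun \<alpha> (exp (1 - a)) (exp (1 - b)) = ennreal ?c"
    by (simp add: hellinger_fun_real powr_def exp_add)
  have trm: "hellinger_fun \<alpha> (poisson_density a (of_nat k)) (poisson_density b (of_nat k)) =
    ennreal ?c * hellinger_fun \<alpha> a b ^ k" for k
    using ab by (simp add: poisson_density_of_nat hellinger_fun_mult hellinger_fun_power c)
  have I: "(\<integral>\<^sup>+x. hellinger_fun \<alpha> (poisson_density a x) (poisson_density b x) \<partial>poisson_law 1) =
    (\<Sum>k. ennreal (exp (- 1) / fact k) * (ennreal ?c * hellinger_fun \<alpha> a b ^ k))"
    by (subst nn_integral_poisson_law_1) (simp_all add: trm)
  show ?thesis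
  proof (cases "\<alpha> < 1 \<or> b > 0")
    case True
    let ?h = "a powr \<alpha> * b powr (1 - \<alpha>)"
    have h: "hellinger_fun \<alpha> a b = ennreal ?h" using True ab by (auto simp: hellinger_fun_real)
    have "(\<lambda>k. exp (- 1) * ?c * (?h ^ k /\<^sub>R fact k)) sums (exp (- 1) * ?c * exp ?h)"
      by (intro sums_mult exp_converges)
    then have "(\<Sum>k. ennreal (exp (- 1) * ?c * (?h ^ k /\<^sub>R fact k))) = ennreal (exp (- 1) * ?c * exp ?h)"
      by (intro suminf_ennreal_eq) auto
    moreover have "exp (- 1) * ?c * exp ?h = exp (?h - \<alpha> * a - (1 - \<alpha>) * b)"
      by (simp add: mult_exp_exp algebra_simps)
    moreover have "tsallis_fun \<alpha> a b = ennreal ((\<alpha> * a + (1 - \<alpha>) * b - ?h) / (1 - \<alpha>))"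
      using True \<alpha> ab by (simp add: tsallis_fun_real)
    moreover have "(\<alpha> - 1) * ((\<alpha> * a + (1 - \<alpha>) * b - ?h) / (1 - \<alpha>)) = ?h - \<alpha> * a - (1 - \<alpha>) * b"
      using \<alpha> by (simp add: field_simps)
    moreover have "ennreal (exp (- 1) / fact k) * (ennreal ?c * ennreal ?h ^ k) = ennreal (exp (- 1) * ?c * (?h ^ k /\<^sub>R fact k))" for k
      by (simp add: ennreal_power field_simps flip: ennreal_mult)
    ultimately show ?thesis
      unfolding I h exp_div_def using tsallis_fun_nonneg_real[OF \<alpha> True ab] by simp
  next
    case False
    then have *: "\<alpha> > 1" "b = 0" using \<alpha> ab by auto
    show ?thesis
    proof (cases "a = 0")
      case True
      have "(\<Sum>k. ennreal (exp (- 1) / fact k) * (ennreal ?c * hellinger_fun \<alpha> a b ^ k)) =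
        (\<Sum>k\<in>{0}. ennreal (exp (- 1) / fact k) * (ennreal ?c * hellinger_fun \<alpha> a b ^ k))"
        by (intro suminf_finite) (auto simp: * True hellinger_fun_0_0 power_0_left)
      also have "\<dots> = 1" using * True by (simp add: mult_exp_exp flip: ennreal_mult)
      finally show ?thesis unfolding I using * True by (simp add: tsallis_fun_0_0)
    next
      case False
      \<comment> \<open>For b = 0 < a above order one the single term k = 1 is already
        infinite.\<close>
      have "(\<Sum>k\<in>{1}. ennreal (exp (- 1) / fact k) * (ennreal ?c * hellinger_fun \<alpha> a b ^ k)) \<le>
        (\<Sum>k. ennreal (exp (- 1) / fact k) * (ennreal ?c * hellinger_fun \<alpha> a b ^ k))"
        by (intro sum_le_suminf) auto
      moreover have "(\<Sum>k\<in>{1}. ennreal (exp (- 1) / fact k) * (ennreal ?c * hellinger_fun \<alpha> a b ^ k)) = \<top>"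
        using * False by (simp add: hellinger_fun_top ennreal_mult_top)
      ultimately show ?thesis unfolding I using * False ab
        by (simp add: tsallis_fun_top exp_div_def top_unique)
    qed
  qed
qed

lemma PiM_eq_density:
  fixes M0 :: "'x measure"
  assumes I: "finite I" and M0: "prob_space M0"
    and h [measurable]: "\<And>i. h i \<in> borel_measurable M0"
    and prob: "\<And>i. prob_space (density M0 (h i))"
  shows "PiM I (\<lambda>i. density M0 (h i)) = density (PiM I (\<lambda>_. M0)) (\<lambda>x. \<Prod>i\<in>I. h i (x i))"
proof -
  interpret D: product_prob_space "\<lambda>i. density M0 (h i)" using prob by (rule product_prob_spaceI)
  interpret M: product_prob_space "\<lambda>_. M0" using M0 by (rule product_prob_spaceI)
  have m: "(\<lambda>x. \<Prod>i\<in>I. h i (x i)) \<in> borel_measurable (PiM I (\<lambda>_. M0))" by measurable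
  show ?thesis
  proof (rule D.PiM_eqI[symmetric])
    show "sets (density (PiM I (\<lambda>_. M0)) (\<lambda>x. \<Prod>i\<in>I. h i (x i))) = sets (PiM I (\<lambda>i. density M0 (h i)))"
      by (simp cong: sets_PiM_cong)
    fix A assume A: "\<And>i. i \<in> I \<Longrightarrow> A i \<in> sets (density M0 (h i))"
    then have [measurable]: "i \<in> I \<Longrightarrow> A i \<in> sets M0" for i by simp
    have "emeasure (density (PiM I (\<lambda>_. M0)) (\<lambda>x. \<Prod>i\<in>I. h i (x i))) (Pi\<^sub>E I A) =
      (\<integral>\<^sup>+x. (\<Prod>i\<in>I. h i (x i)) * indicator (Pi\<^sub>E I A) x \<partial>PiM I (\<lambda>_. M0))"
      using I A by (intro emeasure_density m sets_PiM_I_finite) auto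
    also have "\<dots> = (\<integral>\<^sup>+x. (\<Prod>i\<in>I. h i (x i) * indicator (A i) (x i)) \<partial>PiM I (\<lambda>_. M0))"
    proof (intro nn_integral_cong)
      fix x assume "x \<in> space (PiM I (\<lambda>_. M0))"
      \<comment> \<open>Membership in \<open>Pi\<^sub>E I A\<close> includes extensionality, which
        has to be known before the indicator splits into factors.\<close>
      then have "x \<in> extensional I" by (auto simp: space_PiM PiE_def)
      then have "(indicator (Pi\<^sub>E I A) x :: ennreal) = (\<Prod>i\<in>I. indicator (A i) (x i))"
        using I by (auto simp: indicator_def PiE_def Pi_def intro!: prod_zero[symmetric])
      then show "(\<Prod>i\<in>I. h i (x i)) * indicator (Pi\<^sub>E I A) x = (\<Prod>i\<in>I. h i (x i) * indicator (A i) (x i))"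
        by (simp add: prod.distrib)
    qed
    also have "\<dots> = (\<Prod>i\<in>I. \<integral>\<^sup>+x. h i x * indicator (A i) x \<partial>M0)"
      using I by (intro M.product_nn_integral_prod) measurable
    also have "\<dots> = (\<Prod>i\<in>I. emeasure (density M0 (h i)) (A i))"
      by (intro prod.cong refl emeasure_density[symmetric]) auto
    finally show "emeasure (density (PiM I (\<lambda>_. M0)) (\<lambda>x. \<Prod>i\<in>I. h i (x i))) (Pi\<^sub>E I A) =
      (\<Prod>i\<in>I. emeasure (density M0 (h i)) (A i))" .
  qed fact
qed

section \<open>Vectors of independent Poisson counts\<close>

definition poisson_vector :: "(nat \<Rightarrow> real) \<Rightarrow> nat \<Rightarrow> (nat \<Rightarrow> ennreal) measure" where
  "poisson_vector a n = PiM {..<n} (\<lambda>i. poisson_law (ennreal (a i)))"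

lemma prob_space_poisson_vector: "prob_space (poisson_vector a n)"
  unfolding poisson_vector_def by (intro prob_space_PiM prob_space_poisson_law)

lemma has_density_poisson_vector:
  assumes a: "\<And>i. 0 \<le> a i"
  shows "has_density (PiM {..<n} (\<lambda>_. poisson_law 1)) (poisson_vector a n) (\<lambda>x. \<Prod>i<n. poisson_density (a i) (x i))"
proof -
  note s = sets_poisson_law[of 1, measurable_cong]
  have eq: "poisson_law (ennreal (a i)) = density (poisson_law 1) (\<lambda>x. ennreal (poisson_density (a i) x))" for i
    using a by (rule poisson_law_eq_density)
  have "poisson_vector a n = PiM {..<n} (\<lambda>i. density (poisson_law 1) (\<lambda>x. ennreal (poisson_density (a i) x)))"
    unfolding poisson_vector_def eq ..
  also have "\<dots> = density (PiM {..<n} (\<lambda>_. poisson_law 1)) (\<lambda>x. \<Prod>i<n. ennreal (poisson_density (a i) (x i)))"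
    by (intro PiM_eq_density prob_space_poisson_law) (auto simp: prob_space_poisson_law simp flip: eq)
  finally show ?thesis
    unfolding has_density_def using a by (auto simp: prod_ennreal poisson_density_nonneg intro!: prod_nonneg)
qed

text \<open>Hellinger integrals of product densities factor, and \<open>exp_div\<close> turns the
  product into a sum of exponents. Since the Hellinger integral of probability measures determines
  their Tsallis divergence, the value can be read off.\<close>

lemma var_div_poisson_vector:
  assumes \<alpha>: "0 < \<alpha>" "\<alpha> \<noteq> 1" and ab: "\<And>i. 0 \<le> a i" "\<And>i. 0 \<le> b i"
  shows "var_div \<alpha> (poisson_vector a n) (poisson_vector b n) = power_div \<alpha> (\<Sum>i<n. tsallis_fun \<alpha> (a i) (b i))"
proof -
  let ?m = "PiM {..<n} (\<lambda>_. poisson_law 1)"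
  let ?p = "\<lambda>x. \<Prod>i<n. poisson_density (a i) (x i)" and ?q = "\<lambda>x. \<Prod>i<n. poisson_density (b i) (x i)"
  interpret product_prob_space "\<lambda>_::nat. poisson_law 1" by (intro product_prob_spaceI prob_space_poisson_law)
  note dens = has_density_poisson_vector[of a n, OF ab(1)] has_density_poisson_vector[of b n, OF ab(2)]
  have m: "sigma_finite_measure ?m"
    by (intro prob_space_imp_sigma_finite prob_space_PiM prob_space_poisson_law)
  have "(\<integral>\<^sup>+x. hellinger_fun \<alpha> (?p x) (?q x) \<partial>?m) =
    (\<integral>\<^sup>+x. (\<Prod>i<n. hellinger_fun \<alpha> (poisson_density (a i) (x i)) (poisson_density (b i) (x i))) \<partial>?m)"
    using ab by (simp add: hellinger_fun_prod poisson_density_nonneg)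
  also have "\<dots> = (\<Prod>i<n. \<integral>\<^sup>+x. hellinger_fun \<alpha> (poisson_density (a i) x) (poisson_density (b i) x) \<partial>poisson_law 1)"
    by (intro product_nn_integral_prod) (auto simp: measurable_cong_sets[OF sets_poisson_law refl])
  also have "\<dots> = exp_div \<alpha> (\<Sum>i<n. tsallis_fun \<alpha> (a i) (b i))"
    using ab by (simp add: hellinger_poisson[OF \<alpha>] exp_div_sum)
  finally have H: "(\<integral>\<^sup>+x. hellinger_fun \<alpha> (?p x) (?q x) \<partial>?m) = exp_div \<alpha> (\<Sum>i<n. tsallis_fun \<alpha> (a i) (b i))" .
  have "(\<integral>\<^sup>+x. tsallis_fun \<alpha> (?p x) (?q x) \<partial>?m) = power_div \<alpha> (\<Sum>i<n. tsallis_fun \<alpha> (a i) (b i))"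
  proof (cases "\<alpha> < 1")
    case True
    then show ?thesis using tsallis_hellinger_integral_less[OF \<alpha>(1) True dens prob_space_poisson_vector prob_space_poisson_vector]
      by (intro power_div_unique_less \<alpha>) (auto simp: H)
  next
    case False
    then have "\<alpha> > 1" using \<alpha> by simp
    then show ?thesis using tsallis_hellinger_integral_greater[OF _ dens prob_space_poisson_vector prob_space_poisson_vector]
      by (intro power_div_unique_greater) (auto simp: H)
  qed
  then show ?thesis by (simp add: integral_eq_var_div[OF m dens \<alpha>])
qed


section \<open>Approximation by a generating algebra\<close>

text \<open>Serves twice: as a dominating measure for Radon-Nikodym, and as one measure whose
  smallness controls two measures at the same time.\<close>

definition plus_measure :: "'a measure \<Rightarrow> 'a measure \<Rightarrow> 'a measure" where
  "plus_measure M N = measure_of (space M) (sets M) (\<lambda>A. emeasure M A + emeasure N A)"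

lemma sets_plus_measure [simp]: "sets (plus_measure M N) = sets M"
  by (simp add: plus_measure_def)

lemma space_plus_measure [simp]: "space (plus_measure M N) = space M"
  by (simp add: plus_measure_def)

lemma emeasure_plus_measure:
  assumes "sets N = sets M" "A \<in> sets M"
  shows "emeasure (plus_measure M N) A = emeasure M A + emeasure N A"
  unfolding plus_measure_def
proof (rule emeasure_measure_of_sigma)
  show "countably_additive (sets M) (\<lambda>A. emeasure M A + emeasure N A)"
  proof (rule countably_additiveI)
    fix A :: "nat \<Rightarrow> _" assume A: "range A \<subseteq> sets M" "disjoint_family A"
    then show "(\<Sum>i. emeasure M (A i) + emeasure N (A i)) = emeasure M (\<Union>i. A i) + emeasure N (\<Union>i. A i)"
      using assms(1) by (simp add: suminf_emeasure flip: suminf_add)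
  qed
qed (auto simp: sets.sigma_algebra_axioms positive_def assms)

text \<open>Intersections of members of the two countable covers have finite mass under both
  measures.\<close>

lemma sigma_finite_plus_measure:
  assumes "sets N = sets M" "sigma_finite_measure M" "sigma_finite_measure N"
  shows "sigma_finite_measure (plus_measure M N)"
proof -
  obtain A where A: "countable A" "A \<subseteq> sets M" "\<Union>A = space M" "\<forall>a\<in>A. emeasure M a \<noteq> \<infinity>"
    using sigma_finite_measure.sigma_finite_countable[OF assms(2)] by auto
  obtain B where B: "countable B" "B \<subseteq> sets N" "\<Union>B = space N" "\<forall>a\<in>B. emeasure N a \<noteq> \<infinity>"
    using sigma_finite_measure.sigma_finite_countable[OF assms(3)] by auto
  have sp: "space N = space M" using assms(1) by (rule sets_eq_imp_space_eq)
  show ?thesis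
  proof (standard, intro exI[of _ "(\<lambda>(a, b). a \<inter> b) ` (A \<times> B)"] conjI ballI)
    show "\<Union> ((\<lambda>(a, b). a \<inter> b) ` (A \<times> B)) = space (plus_measure M N)"
    proof -
      have "\<Union> ((\<lambda>(a, b). a \<inter> b) ` (A \<times> B)) = \<Union>A \<inter> \<Union>B" by blast
      then show ?thesis using A(3) B(3) sp by simp
    qed
    fix c assume "c \<in> (\<lambda>(a, b). a \<inter> b) ` (A \<times> B)"
    then obtain a b where c: "c = a \<inter> b" "a \<in> A" "b \<in> B" by auto
    then have s: "a \<in> sets M" "b \<in> sets M" using A(2) B(2) assms(1) by auto
    have "emeasure M c \<le> emeasure M a" "emeasure N c \<le> emeasure N b"
      using s assms(1) by (auto simp: c(1) intro!: emeasure_mono)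
    moreover have "emeasure M a < \<infinity>" "emeasure N b < \<infinity>" using A(4) B(4) c by (auto simp: less_top)
    ultimately show "emeasure (plus_measure M N) c \<noteq> \<infinity>"
      using s by (auto simp: emeasure_plus_measure[OF assms(1)] c(1) top_unique)
  qed (use A B assms(1) in auto)
qed

text \<open>The approximable sets form a sigma-algebra: complements leave the symmetric difference
  unchanged, and a countable union is first cut off at a finite stage.\<close>

lemma algebra_approximation:
  assumes alg: "algebra \<Omega> G" and M: "finite_measure M" "space M = \<Omega>" "sets M = sigma_sets \<Omega> G"
    and A: "A \<in> sets M" and \<epsilon>: "0 < (\<epsilon>::real)"
  shows "\<exists>B\<in>G. measure M ((A - B) \<union> (B - A)) < \<epsilon>"
proof -
  interpret algebra \<Omega> G by fact
  interpret M: finite_measure M by fact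
  have G: "B \<in> sets M" if "B \<in> G" for B using that M(3) by auto
  have "A \<in> sigma_sets \<Omega> G" using A M(3) by simp
  then show ?thesis using \<epsilon>
  proof (induction arbitrary: \<epsilon>)
    case (Basic a)
    then show ?case by (intro bexI[of _ a]) auto
  next
    case Empty
    then show ?case by (intro bexI[of _ "{}"]) auto
  next
    case (Compl a)
    then obtain B where B: "B \<in> G" "measure M ((a - B) \<union> (B - a)) < \<epsilon>" by blast
    have "a \<subseteq> \<Omega>" "B \<subseteq> \<Omega>" using Compl.hyps M sets.sets_into_space G[OF B(1)] by auto
    then have "((\<Omega> - a) - (\<Omega> - B)) \<union> ((\<Omega> - B) - (\<Omega> - a)) = (a - B) \<union> (B - a)" by auto
    then show ?case using B by (intro bexI[of _ "\<Omega> - B"]) auto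
  next
    case (Union a)
    have a: "a i \<in> sets M" for i using Union.hyps M(3) by simp
    have "(\<lambda>n. measure M (\<Union>i<n. a i)) \<longlonglongrightarrow> measure M (\<Union>n. \<Union>i<n. a i)"
    proof (rule M.finite_Lim_measure_incseq)
      show "range (\<lambda>n. \<Union>i<n. a i) \<subseteq> sets M" using a by (intro image_subsetI sets.finite_UN) auto
      show "incseq (\<lambda>n. \<Union>i<n. a i)" by (intro monoI UN_mono) auto
    qed
    moreover have "(\<Union>n. \<Union>i<n. a i) = (\<Union>i. a i)" by auto
    ultimately have "eventually (\<lambda>n. measure M (\<Union>i. a i) - \<epsilon> / 2 < measure M (\<Union>i<n. a i)) sequentially"
      using Union.prems by (intro order_tendstoD(1)[of _ "measure M (\<Union>i. a i)"]) auto
    then obtain N where N: "measure M (\<Union>i. a i) - \<epsilon> / 2 < measure M (\<Union>i<N. a i)"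
      by (auto simp: eventually_sequentially)
    \<comment> \<open>Half of \<epsilon> pays for the cut-off, the other half for the N
      approximations; the + 1 avoids division by 0 when N = 0.\<close>
    define \<delta> where "\<delta> = \<epsilon> / (2 * (real N + 1))"
    have "\<delta> > 0" using Union.prems by (simp add: \<delta>_def)
    then have "\<exists>B\<in>G. measure M ((a i - B) \<union> (B - a i)) < \<delta>" for i using Union.IH by blast
    then obtain B where B: "\<And>i. B i \<in> G" "\<And>i. measure M ((a i - B i) \<union> (B i - a i)) < \<delta>" by metis
    let ?d = "\<lambda>i. (a i - B i) \<union> (B i - a i)" and ?B = "\<Union>i<N. B i"
    have d: "?d i \<in> sets M" for i using a G[OF B(1)] by auto
    have "((\<Union>i. a i) - ?B) \<union> (?B - (\<Union>i. a i)) \<subseteq> ((\<Union>i. a i) - (\<Union>i<N. a i)) \<union> (\<Union>i<N. ?d i)"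
      by auto
    then have "measure M (((\<Union>i. a i) - ?B) \<union> (?B - (\<Union>i. a i))) \<le> measure M (((\<Union>i. a i) - (\<Union>i<N. a i)) \<union> (\<Union>i<N. ?d i))"
      using a d by (intro M.finite_measure_mono) auto
    also have "\<dots> \<le> measure M ((\<Union>i. a i) - (\<Union>i<N. a i)) + measure M (\<Union>i<N. ?d i)"
      using a d by (intro measure_Un_le) auto
    also have "measure M ((\<Union>i. a i) - (\<Union>i<N. a i)) = measure M (\<Union>i. a i) - measure M (\<Union>i<N. a i)"
      using a by (intro M.finite_measure_Diff) auto
    also have "\<dots> < \<epsilon> / 2" using N by simp
    also have "measure M (\<Union>i<N. ?d i) \<le> (\<Sum>i<N. measure M (?d i))"
      using d by (intro M.finite_measure_subadditive_finite) auto
    also have "\<dots> \<le> (\<Sum>i<N. \<delta>)" using B(2) by (intro sum_mono less_imp_le) auto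
    also have "\<dots> = real N * \<delta>" by simp
    also have "\<dots> \<le> \<epsilon> / 2" using Union.prems by (simp add: \<delta>_def field_simps)
    finally have "measure M (((\<Union>i. a i) - ?B) \<union> (?B - (\<Union>i. a i))) < \<epsilon>" by simp
    moreover have "?B \<in> G" using B(1) by auto
    ultimately show ?case by blast
  qed
qed

text \<open>Each sum \<open>var_val\<close> depends continuously on its sets with respect to
  symmetric differences under P + Q, so families from a generating algebra suffice for the
  supremum.\<close>

lemma var_div_le_algebra:
  assumes alg: "algebra \<Omega> G" and P: "finite_measure P" "space P = \<Omega>" "sets P = sigma_sets \<Omega> G"
    and Q: "finite_measure Q" "sets Q = sets P"
    and le: "\<And>m t A. (\<And>k. k < m \<Longrightarrow> A k \<in> G) \<Longrightarrow> fin_family P Q m A \<Longrightarrow> (\<And>k. t k > 0) \<Longrightarrow>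
      ennreal (var_val \<alpha> P Q m t A) \<le> c"
  shows "var_div \<alpha> P Q \<le> c"
proof (rule var_div_least)
  fix m A and t :: "nat \<Rightarrow> real" assume A: "fin_family P Q m A" and t: "\<And>k. t k > 0"
  interpret algebra \<Omega> G by fact
  interpret P: finite_measure P by fact
  interpret Q: finite_measure Q by fact
  let ?R = "plus_measure P Q"
  note R = emeasure_plus_measure[OF Q(2)]
  have "space Q = space P" using Q(2) by (rule sets_eq_imp_space_eq)
  then have "emeasure ?R (space ?R) = emeasure P (space P) + emeasure Q (space Q)"
    using R[of "space P"] by simp
  then interpret R: finite_measure ?R
    by (intro finite_measureI) simp
  have le_R: "measure P X \<le> measure ?R X" "measure Q X \<le> measure ?R X" if "X \<in> sets P" for X
    using that Q(2) by (auto simp: measure_def R simp flip: less_top intro!: enn2real_mono)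
  have G: "B \<in> sets P" if "B \<in> G" for B using that P(3) by auto
  have Am: "A k \<in> sets P" if "k < m" for k using A that by (simp add: fin_family_def)
  have "\<exists>B\<in>G. k < m \<longrightarrow> measure ?R ((A k - B) \<union> (B - A k)) < 1 / (real n + 1)" for k n
    using algebra_approximation[OF alg R.finite_measure_axioms, of "A k" "1 / (real n + 1)"] P Am[of k] by auto
  then have "\<forall>p. \<exists>B. B \<in> G \<and> (fst p < m \<longrightarrow> measure ?R ((A (fst p) - B) \<union> (B - A (fst p))) < 1 / (real (snd p) + 1))" by blast
  from choice[OF this] obtain B' where B': "\<forall>p. B' p \<in> G \<and>
      (fst p < m \<longrightarrow> measure ?R ((A (fst p) - B' p) \<union> (B' p - A (fst p))) < 1 / (real (snd p) + 1))" ..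
  define B where "B n k = B' (k, n)" for n k
  have B: "\<And>k n. B n k \<in> G"
    and Bd: "\<And>k n. k < m \<Longrightarrow> measure ?R ((A k - B n k) \<union> (B n k - A k)) < 1 / (real n + 1)"
    unfolding B_def using B' by force+
  \<comment> \<open>The approximants may overlap. Removing the earlier ones is cheap because the A k
    are disjoint: a point of A k lying in an earlier B n j is outside A j, hence in the error set of
    j.\<close>
  define D where "D n k = B n k - (\<Union>j<k. B n j)" for n k
  have D: "D n k \<in> G" for n k unfolding D_def using B by auto
  have Dfam: "fin_family P Q m (D n)" for n
  proof -
    have "disjoint_family_on (D n) {..<m}"
      unfolding disjoint_family_on_def D_def
    proof (intro ballI impI equals0I)
      fix i j x assume "i \<noteq> j" "x \<in> (B n i - \<Union> (B n ` {..<i})) \<inter> (B n j - \<Union> (B n ` {..<j}))"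
      then show False by (cases "i < j") auto
    qed
    then show ?thesis using G[OF D] by (auto simp: fin_family_def simp flip: less_top)
  qed
  have close: "measure ?R ((A k - D n k) \<union> (D n k - A k)) \<le> real m * (1 / (real n + 1))" if k: "k < m" for n k
  proof -
    let ?d = "\<lambda>i. (A i - B n i) \<union> (B n i - A i)"
    have d: "?d i \<in> sets ?R" if "i < m" for i using Am[OF that] G[OF B] by auto
    have "(A k - D n k) \<union> (D n k - A k) \<subseteq> (\<Union>i<m. ?d i)"
    proof
      fix x assume x: "x \<in> (A k - D n k) \<union> (D n k - A k)"
      show "x \<in> (\<Union>i<m. ?d i)"
      proof (cases "x \<in> A k")
        case True
        have "x \<notin> A j" if "j < k" for j
          using disjoint_family_onD[of A "{..<m}" j k] A that k True by (auto simp: fin_family_def)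
        then show ?thesis using True x k unfolding D_def by (auto intro: less_trans)
      next
        case False
        then show ?thesis using x k unfolding D_def by auto
      qed
    qed
    then have "measure ?R ((A k - D n k) \<union> (D n k - A k)) \<le> measure ?R (\<Union>i<m. ?d i)"
      using d by (intro R.finite_measure_mono) auto
    also have "\<dots> \<le> (\<Sum>i<m. measure ?R (?d i))"
      using d by (intro R.finite_measure_subadditive_finite) auto
    also have "\<dots> \<le> (\<Sum>i<m. 1 / (real n + 1))" using Bd by (intro sum_mono less_imp_le) auto
    finally show ?thesis by simp
  qed
  have lim0: "(\<lambda>n. real m * (1 / (real n + 1))) \<longlonglongrightarrow> 0" by real_asymp
  have lim: "(\<lambda>n. measure N (D n k)) \<longlonglongrightarrow> measure N (A k)"
    if k: "k < m" and N: "finite_measure N" "sets N = sets P" "\<And>X. X \<in> sets P \<Longrightarrow> measure N X \<le> measure ?R X" for k N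
  proof -
    interpret N: finite_measure N by fact
    have "\<bar>measure N (D n k) - measure N (A k)\<bar> \<le> real m * (1 / (real n + 1))" for n
    proof -
      let ?S = "(A k - D n k) \<union> (D n k - A k)"
      have S: "?S \<in> sets P" "A k \<in> sets P" "D n k \<in> sets P" using Am[OF k] G[OF D] by auto
      have "measure N (D n k) \<le> measure N (A k \<union> ?S)" "measure N (A k) \<le> measure N (D n k \<union> ?S)"
        using S N(2) by (auto intro!: N.finite_measure_mono)
      moreover have "measure N (A k \<union> ?S) \<le> measure N (A k) + measure N ?S" "measure N (D n k \<union> ?S) \<le> measure N (D n k) + measure N ?S"
        using S N(2) by (auto intro!: measure_Un_le)
      moreover have "measure N ?S \<le> real m * (1 / (real n + 1))" using N(3)[OF S(1)] close[OF k, of n] by linarith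
      ultimately show ?thesis by linarith
    qed
    then have "(\<lambda>n. measure N (D n k) - measure N (A k)) \<longlonglongrightarrow> 0"
      by (intro Lim_null_comparison[OF _ lim0]) auto
    then show ?thesis by (simp add: LIM_zero_iff)
  qed
  \<comment> \<open>The parameters t stay fixed, so only a linear function of finitely many masses
    has to converge.\<close>
  have "(\<lambda>n. var_val \<alpha> P Q m t (D n)) \<longlonglongrightarrow> var_val \<alpha> P Q m t A"
    unfolding var_val_def tangent_def
    using lim[OF _ P.finite_measure_axioms refl le_R(1)] lim[OF _ Q.finite_measure_axioms Q(2) le_R(2)]
    by (intro tendsto_sum tendsto_intros) auto
  then have "(\<lambda>n. ennreal (var_val \<alpha> P Q m t (D n))) \<longlonglongrightarrow> ennreal (var_val \<alpha> P Q m t A)" by simp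
  then show "ennreal (var_val \<alpha> P Q m t A) \<le> c"
    by (rule tendsto_upperbound) (use le[OF D Dfam t] in auto)
qed

lemma var_val_distr:
  assumes "X \<in> P \<rightarrow>\<^sub>M N" "sets Q = sets P" "\<And>k. k < m \<Longrightarrow> E k \<in> sets N"
  shows "var_val \<alpha> (distr P N X) (distr Q N X) m t E = var_val \<alpha> P Q m t (\<lambda>k. X -` E k \<inter> space P)"
proof -
  have "X \<in> Q \<rightarrow>\<^sub>M N" using assms(1,2) by (simp cong: measurable_cong_sets)
  then show ?thesis unfolding var_val_def
    using assms sets_eq_imp_space_eq[OF assms(2)] by (intro sum.cong) (auto simp: measure_distr)
qed

text \<open>Data processing inequality: preimages under X turn an admissible family of the images
  into one of P and Q with the same value.\<close>

lemma var_div_distr_le: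
  assumes X: "X \<in> P \<rightarrow>\<^sub>M N" and sets: "sets Q = sets P" and fin: "finite_measure P" "finite_measure Q"
  shows "var_div \<alpha> (distr P N X) (distr Q N X) \<le> var_div \<alpha> P Q"
proof (rule var_div_least)
  fix m E and t :: "nat \<Rightarrow> real" assume E: "fin_family (distr P N X) (distr Q N X) m E" and t: "\<And>k. t k > 0"
  interpret P: finite_measure P by fact
  interpret Q: finite_measure Q by fact
  have "disjoint_family_on (\<lambda>k. X -` E k \<inter> space P) {..<m}"
    using E unfolding fin_family_def disjoint_family_on_def by blast
  then have "fin_family P Q m (\<lambda>k. X -` E k \<inter> space P)"
    using E X by (auto simp: fin_family_def simp flip: less_top)
  then have "ennreal (var_val \<alpha> P Q m t (\<lambda>k. X -` E k \<inter> space P)) \<le> var_div \<alpha> P Q"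
    using t by (intro var_val_le_var_div)
  then show "ennreal (var_val \<alpha> (distr P N X) (distr Q N X) m t E) \<le> var_div \<alpha> P Q"
    using E by (subst var_val_distr[OF X sets]) (auto simp: fin_family_def)
qed


section \<open>Counting maps of point patterns\<close>

text \<open>The disjoint sets are the atoms of the finite set algebra generated by C. This reduces
  counts of arbitrary overlapping sets to independent ones.\<close>

lemma finite_family_refinement:
  assumes C: "finite C" "\<And>B. B \<in> C \<Longrightarrow> B \<in> sets \<Lambda> \<and> emeasure \<Lambda> B < \<infinity> \<and> emeasure \<Lambda>' B < \<infinity>"
    and sets: "sets \<Lambda>' = sets \<Lambda>"
  shows "\<exists>n D. fin_family \<Lambda> \<Lambda>' n D \<and> (\<forall>B\<in>C. \<exists>J\<subseteq>{..<n}. B = (\<Union>j\<in>J. D j))"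
proof -
  \<comment> \<open>Points lying in exactly the members T of C. The restriction to the union of C
    keeps the masses finite, in particular for T = {}, whose atom is empty.\<close>
  define atom where "atom T = {x \<in> \<Union>C. {B \<in> C. x \<in> B} = T}" for T
  obtain e where "bij_betw e {0..<card (Pow C)} (Pow C)"
    using ex_bij_betw_nat_finite[of "Pow C"] C(1) by auto
  then have e: "inj_on e {..<card (Pow C)}" "e ` {..<card (Pow C)} = Pow C"
    by (auto simp: bij_betw_def atLeast0LessThan)
  let ?n = "card (Pow C)"
  have UC: "\<Union>C \<in> sets \<Lambda>" "emeasure \<Lambda> (\<Union>C) < \<infinity>" "emeasure \<Lambda>' (\<Union>C) < \<infinity>"
  proof -
    show "\<Union>C \<in> sets \<Lambda>" using C by (intro sets.finite_Union) auto
    have "emeasure N (\<Union>C) < \<infinity>" if "\<And>B. B \<in> C \<Longrightarrow> B \<in> sets N \<and> emeasure N B < \<infinity>" for N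
    proof -
      have "emeasure N (\<Union>B\<in>C. B) \<le> (\<Sum>B\<in>C. emeasure N B)"
        using C(1) that by (intro emeasure_subadditive_finite) auto
      also have "\<dots> < \<infinity>" using that C(1) by simp
      finally show ?thesis by simp
    qed
    then show "emeasure \<Lambda> (\<Union>C) < \<infinity>" "emeasure \<Lambda>' (\<Union>C) < \<infinity>" using C(2) sets by auto
  qed
  have atom: "atom T \<in> sets \<Lambda>" if "T \<subseteq> C" for T
  proof -
    have "atom T = {x \<in> space \<Lambda>. x \<in> \<Union>C \<and> (\<forall>B\<in>C. x \<in> B \<longleftrightarrow> B \<in> T)}"
      using that sets.sets_into_space[OF UC(1)] unfolding atom_def by blast
    also have "\<dots> \<in> sets \<Lambda>"
    proof (intro sets.sets_Collect_conj sets.sets_Collect_finite_All C(1))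
      show "{x \<in> space \<Lambda>. x \<in> \<Union> C} \<in> sets \<Lambda>" using UC(1) by measurable
      fix B assume "B \<in> C"
      then have [measurable]: "B \<in> sets \<Lambda>" using C(2) by simp
      show "{x \<in> space \<Lambda>. (x \<in> B) = (B \<in> T)} \<in> sets \<Lambda>" by measurable
    qed
    finally show ?thesis .
  qed
  have "fin_family \<Lambda> \<Lambda>' ?n (\<lambda>i. atom (e i))"
    unfolding fin_family_def
  proof (intro conjI allI impI)
    show "disjoint_family_on (\<lambda>i. atom (e i)) {..<?n}"
      using e(1) by (auto simp: disjoint_family_on_def atom_def inj_on_def)
    fix k assume "k < ?n"
    then have k: "e k \<subseteq> C" using e(2) by blast
    show at: "atom (e k) \<in> sets \<Lambda>" using k by (rule atom)
    have "atom (e k) \<subseteq> \<Union>C" by (auto simp: atom_def)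
    then have "emeasure \<Lambda> (atom (e k)) \<le> emeasure \<Lambda> (\<Union>C)" "emeasure \<Lambda>' (atom (e k)) \<le> emeasure \<Lambda>' (\<Union>C)"
      using UC(1) sets by (auto intro!: emeasure_mono)
    then show "emeasure \<Lambda> (atom (e k)) < \<infinity>" "emeasure \<Lambda>' (atom (e k)) < \<infinity>"
      using UC(2,3) by (auto intro: le_less_trans)
  qed
  moreover have *: "B = (\<Union>j\<in>{j\<in>{..<?n}. B \<in> e j}. atom (e j))" if "B \<in> C" for B
  proof
    show "(\<Union>j\<in>{j\<in>{..<?n}. B \<in> e j}. atom (e j)) \<subseteq> B" by (auto simp: atom_def)
    show "B \<subseteq> (\<Union>j\<in>{j\<in>{..<?n}. B \<in> e j}. atom (e j))"
    proof
      fix x assume x: "x \<in> B"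
      have "{B \<in> C. x \<in> B} \<in> e ` {..<?n}" unfolding e(2) by auto
      then obtain j where "{B \<in> C. x \<in> B} = e j" "j \<in> {..<?n}" by (elim imageE)
      moreover from this(1) have "x \<in> atom (e j)" "B \<in> e j" using x that by (auto simp: atom_def)
      ultimately show "x \<in> (\<Union>j\<in>{j\<in>{..<?n}. B \<in> e j}. atom (e j))" by blast
    qed
  qed
  moreover have "\<exists>J\<subseteq>{..<?n}. B = (\<Union>j\<in>J. atom (e j))" if "B \<in> C" for B
  proof (intro exI conjI)
    show "B = (\<Union>j\<in>{j\<in>{..<?n}. B \<in> e j}. atom (e j))" by (rule *[OF that])
  qed blast
  ultimately show ?thesis by blast
qed

section \<open>The space of point patterns and its cylinder sets\<close>

lemma point_pattern_sets: "\<eta> \<in> point_patterns S \<Longrightarrow> sets \<eta> = sets S"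
  by (simp add: point_patterns_def)

lemma space_point_pattern_space [simp]: "space (point_pattern_space S) = point_patterns S"
  by (auto simp: point_pattern_space_def space_measure_of_conv)

lemma sets_point_pattern_space: "sets (point_pattern_space S) = sigma_sets (point_patterns S)
   {(\<lambda>\<eta>. emeasure \<eta> B) -` A \<inter> point_patterns S | A B. A \<in> sets borel \<and> B \<in> sets S}"
  unfolding point_pattern_space_def by (rule sets_measure_of) auto

lemma emeasure_point_pattern_measurable:
  assumes "B \<in> sets S"
  shows "(\<lambda>\<eta>. emeasure \<eta> B) \<in> borel_measurable (point_pattern_space S)"
  by (rule measurableI) (use assms in \<open>auto simp: sets_point_pattern_space intro!: sigma_sets.Basic\<close>)

lemma point_pattern_space_cong:
  assumes "sets S = sets S'" shows "point_pattern_space S = point_pattern_space S'"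
  using assms by (simp add: point_pattern_space_def point_patterns_def)

definition counts :: "nat \<Rightarrow> (nat \<Rightarrow> 'a set) \<Rightarrow> 'a measure \<Rightarrow> nat \<Rightarrow> ennreal" where
  "counts n B \<eta> = (\<lambda>i\<in>{..<n}. emeasure \<eta> (B i))"

lemma counts_measurable:
  assumes "\<And>i. i < n \<Longrightarrow> B i \<in> sets S"
  shows "counts n B \<in> point_pattern_space S \<rightarrow>\<^sub>M PiM {..<n} (\<lambda>_. borel)"
  unfolding counts_def[abs_def]
  by (intro measurable_restrict emeasure_point_pattern_measurable) (use assms in auto)

lemma distr_counts:
  assumes P: "poisson_pp_distribution \<Lambda> P" and B: "fin_family \<Lambda> \<Lambda>' n B"
  shows "distr P (PiM {..<n} (\<lambda>_. borel)) (counts n B) = poisson_vector (\<lambda>i. measure \<Lambda> (B i)) n"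
proof -
  interpret prob_space P using P by (simp add: poisson_pp_distribution_def)
  have sP: "sets P = sets (point_pattern_space \<Lambda>)" using P by (simp add: poisson_pp_distribution_def)
  have Bi: "B i \<in> sets \<Lambda>" "emeasure \<Lambda> (B i) = ennreal (measure \<Lambda> (B i))" if "i < n" for i
    using B that by (auto simp: fin_family_def measure_def)
  have cm: "counts n B \<in> P \<rightarrow>\<^sub>M PiM {..<n} (\<lambda>_. borel)"
    using counts_measurable[of n B \<Lambda>] Bi(1) by (simp add: measurable_cong_sets[OF sP refl])
  show ?thesis
  proof (cases "n = 0")
    \<comment> \<open>The product criterion for independence asks for a nonempty index set; without
      counts both laws live on a single point.\<close>
    case True
    interpret D: product_prob_space "\<lambda>_. poisson_law (ennreal 0)" by (intro product_prob_spaceI prob_space_poisson_law)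
    have "emeasure (distr P (PiM {..<n} (\<lambda>_. borel)) (counts n B)) {\<lambda>_. undefined} = 1"
    proof -
      have "space (PiM {..<n} (\<lambda>_. borel :: ennreal measure)) = {\<lambda>_. undefined}" using True by (simp add: space_PiM)
      then show ?thesis using prob_space.emeasure_space_1[OF prob_space_distr[OF cm]] by simp
    qed
    then show ?thesis unfolding poisson_vector_def
      using True by (intro measure_eqI) (auto simp: sets_PiM_empty PiM_empty subset_singleton_iff)
  next
    case False
    have rv: "random_variable borel (\<lambda>\<eta>. emeasure \<eta> (B i))" if "i \<in> {..<n}" for i
      using emeasure_point_pattern_measurable[OF Bi(1)] that by (simp add: measurable_cong_sets[OF sP refl])
    have "indep_vars (\<lambda>_. borel) (\<lambda>i \<eta>. emeasure \<eta> (B i)) {..<n}"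
      using P B unfolding poisson_pp_distribution_def fin_family_def by blast
    then have "distr P (PiM {..<n} (\<lambda>_. borel)) (counts n B) = PiM {..<n} (\<lambda>i. distr P borel (\<lambda>\<eta>. emeasure \<eta> (B i)))"
      unfolding counts_def[abs_def] using False rv by (subst (asm) indep_vars_iff_distr_eq_PiM') auto
    also have "\<dots> = PiM {..<n} (\<lambda>i. poisson_law (ennreal (measure \<Lambda> (B i))))"
      using P Bi by (intro PiM_cong) (auto simp: poisson_pp_distribution_def simp flip: Bi(2))
    finally show ?thesis by (simp add: poisson_vector_def)
  qed
qed

text \<open>The base sets are disjoint and of finite mass so that the counts are independent with
  real means and \<open>distr_counts\<close> applies directly.\<close>

definition cylinders :: "'a measure \<Rightarrow> 'a measure \<Rightarrow> 'a measure set set" where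
  "cylinders \<Lambda> \<Lambda>' = {counts n B -` E \<inter> point_patterns \<Lambda> | n B E.
     fin_family \<Lambda> \<Lambda>' n B \<and> E \<in> sets (PiM {..<n} (\<lambda>_. borel))}"

text \<open>Every base set involved is a disjoint union of common atoms, and a point pattern is
  additive. All counts are therefore measurable functions of the counts of the atoms.\<close>

lemma cylinders_common_base:
  fixes m :: nat
  assumes sets: "sets \<Lambda>' = sets \<Lambda>" and A: "\<forall>k<m. A k \<in> cylinders \<Lambda> \<Lambda>'"
  shows "\<exists>n D E. fin_family \<Lambda> \<Lambda>' n D \<and>
    (\<forall>k<m. E k \<in> sets (PiM {..<n} (\<lambda>_. borel)) \<and> A k = counts n D -` E k \<inter> point_patterns \<Lambda>)"
proof -
  have "\<forall>k. \<exists>n B E. k < m \<longrightarrow> (fin_family \<Lambda> \<Lambda>' n B \<and> E \<in> sets (PiM {..<n} (\<lambda>_. borel)) \<and>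
     A k = counts n B -` E \<inter> point_patterns \<Lambda>)"
    using A unfolding cylinders_def by blast
  then obtain N B E where NBE: "\<And>k. k < m \<Longrightarrow> fin_family \<Lambda> \<Lambda>' (N k) (B k)"
    "\<And>k. k < m \<Longrightarrow> E k \<in> sets (PiM {..<N k} (\<lambda>_. borel))"
    "\<And>k. k < m \<Longrightarrow> A k = counts (N k) (B k) -` E k \<inter> point_patterns \<Lambda>" by metis
  define C where "C = (\<Union>k<m. B k ` {..<N k})"
  have "finite C" by (simp add: C_def)
  moreover have "X \<in> sets \<Lambda> \<and> emeasure \<Lambda> X < \<infinity> \<and> emeasure \<Lambda>' X < \<infinity>" if "X \<in> C" for X
    using that NBE(1) by (auto simp: C_def fin_family_def)
  ultimately obtain n D where D: "fin_family \<Lambda> \<Lambda>' n D" "\<forall>X\<in>C. \<exists>J\<subseteq>{..<n}. X = (\<Union>j\<in>J. D j)"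
    using finite_family_refinement[OF _ _ sets] by metis
  then obtain J where J: "\<And>X. X \<in> C \<Longrightarrow> J X \<subseteq> {..<n}" "\<And>X. X \<in> C \<Longrightarrow> X = (\<Union>j\<in>J X. D j)" by metis
  \<comment> \<open>Recovers the k-th count vector from the counts of the atoms by
    summation.\<close>
  define h where "h k y = (\<lambda>i\<in>{..<N k}. \<Sum>j\<in>J (B k i). y j)" for k and y :: "nat \<Rightarrow> ennreal"
  have inC: "B k i \<in> C" if "k < m" "i < N k" for k i using that by (auto simp: C_def)
  have h: "h k \<in> PiM {..<n} (\<lambda>_. borel) \<rightarrow>\<^sub>M PiM {..<N k} (\<lambda>_. borel)" if "k < m" for k
    unfolding h_def[abs_def]
  proof (intro measurable_restrict borel_measurable_sum)
    fix i j assume "i \<in> {..<N k}" "j \<in> J (B k i)"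
    then have "j \<in> {..<n}" using J(1)[OF inC[OF that, of i]] by auto
    then show "(\<lambda>y. y j) \<in> borel_measurable (PiM {..<n} (\<lambda>_. borel))" by (rule measurable_component_singleton)
  qed
  have hc: "h k (counts n D \<eta>) = counts (N k) (B k) \<eta>" if k: "k < m" and \<eta>: "\<eta> \<in> point_patterns \<Lambda>" for k \<eta>
  proof (rule ext)
    fix i
    show "h k (counts n D \<eta>) i = counts (N k) (B k) \<eta> i"
    proof (cases "i < N k")
      case True
      note JB = J[OF inC[OF k True]]
      have "(\<Sum>j\<in>J (B k i). emeasure \<eta> (D j)) = emeasure \<eta> (\<Union>j\<in>J (B k i). D j)"
      proof (rule sum_emeasure)
        show "D ` J (B k i) \<subseteq> sets \<eta>" using JB(1) D(1) point_pattern_sets[OF \<eta>] by (auto simp: fin_family_def)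
        show "disjoint_family_on D (J (B k i))" using JB(1) D(1) unfolding fin_family_def
          by (metis disjoint_family_on_mono)
        show "finite (J (B k i))" using JB(1) finite_subset by blast
      qed
      also have "\<dots> = emeasure \<eta> (B k i)" using JB(2) by simp
      moreover have "(\<Sum>j\<in>J (B k i). counts n D \<eta> j) = (\<Sum>j\<in>J (B k i). emeasure \<eta> (D j))"
        using JB(1) by (intro sum.cong) (auto simp: counts_def)
      ultimately show ?thesis using True by (simp add: h_def counts_def)
    qed (simp add: h_def counts_def)
  qed
  have sp: "counts n D \<eta> \<in> space (PiM {..<n} (\<lambda>_. borel))" for \<eta>
    by (auto simp: counts_def space_PiM)
  show ?thesis
  proof (intro exI conjI allI impI)
    show "fin_family \<Lambda> \<Lambda>' n D" by fact
    fix k assume k: "k < m"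
    show "h k -` E k \<inter> space (PiM {..<n} (\<lambda>_. borel)) \<in> sets (PiM {..<n} (\<lambda>_. borel))"
      using h[OF k] NBE(2)[OF k] by (rule measurable_sets)
    show "A k = counts n D -` (h k -` E k \<inter> space (PiM {..<n} (\<lambda>_. borel))) \<inter> point_patterns \<Lambda>"
      unfolding NBE(3)[OF k] using hc[OF k] sp by auto
  qed
qed

lemma algebra_cylinders:
  assumes sets: "sets \<Lambda>' = sets \<Lambda>"
  shows "algebra (point_patterns \<Lambda>) (cylinders \<Lambda> \<Lambda>')"
  unfolding algebra_iff_Un
proof (intro conjI ballI)
  let ?G = "cylinders \<Lambda> \<Lambda>'"
  show "?G \<subseteq> Pow (point_patterns \<Lambda>)" by (auto simp: cylinders_def)
  have fam0: "fin_family \<Lambda> \<Lambda>' 0 (\<lambda>_. {})" by (simp add: fin_family_def disjoint_family_on_def)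
  have cylI: "counts n D -` E \<inter> point_patterns \<Lambda> \<in> ?G"
    if "fin_family \<Lambda> \<Lambda>' n D" "E \<in> sets (PiM {..<n} (\<lambda>_. borel))" for n D E
    using that unfolding cylinders_def by blast
  show "{} \<in> ?G" using cylI[OF fam0 sets.empty_sets] by simp
  fix a assume a: "a \<in> ?G"
  then obtain n D E where *: "fin_family \<Lambda> \<Lambda>' n D" "E \<in> sets (PiM {..<n} (\<lambda>_. borel))"
    "a = counts n D -` E \<inter> point_patterns \<Lambda>" unfolding cylinders_def by blast
  have "point_patterns \<Lambda> - a = counts n D -` (space (PiM {..<n} (\<lambda>_. borel)) - E) \<inter> point_patterns \<Lambda>"
    by (auto simp: *(3) counts_def space_PiM)
  then show "point_patterns \<Lambda> - a \<in> ?G" using cylI[OF *(1) sets.compl_sets[OF *(2)]] by simp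
  fix b assume b: "b \<in> ?G"
  \<comment> \<open>The two sets are packed into a family of length 2 to obtain a common base for
    both.\<close>
  let ?A = "\<lambda>k::nat. if k = 0 then a else b"
  have A: "\<forall>k<2. ?A k \<in> ?G" using a b by simp
  obtain n D E where "fin_family \<Lambda> \<Lambda>' n D \<and>
    (\<forall>k<2. E k \<in> sets (PiM {..<n} (\<lambda>_. borel)) \<and> ?A k = counts n D -` E k \<inter> point_patterns \<Lambda>)"
    using cylinders_common_base[of \<Lambda>' \<Lambda> 2 ?A, OF sets A] by (elim exE)
  then have *: "fin_family \<Lambda> \<Lambda>' n D"
    "\<And>k. k < 2 \<Longrightarrow> E k \<in> sets (PiM {..<n} (\<lambda>_. borel)) \<and> ?A k = counts n D -` E k \<inter> point_patterns \<Lambda>"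
    by simp_all
  have E: "E 0 \<in> sets (PiM {..<n} (\<lambda>_. borel))" "E 1 \<in> sets (PiM {..<n} (\<lambda>_. borel))"
    "a = counts n D -` E 0 \<inter> point_patterns \<Lambda>" "b = counts n D -` E 1 \<inter> point_patterns \<Lambda>"
    using *(2)[of 0] *(2)[of 1] by simp_all
  have "a \<union> b = counts n D -` (E 0 \<union> E 1) \<inter> point_patterns \<Lambda>" unfolding E(3,4) by auto
  then show "a \<union> b \<in> ?G" using cylI[OF *(1) sets.Un[OF E(1,2)]] by simp
qed

text \<open>Cylinders see only sets of finite mass. For an arbitrary B the count is the countable
  sum of the counts of B on the pieces of a partition that is finite under both measures, which is
  where sigma-finiteness enters.\<close>

lemma sigma_sets_cylinders:
  assumes sets: "sets \<Lambda>' = sets \<Lambda>" and sf: "sigma_finite_measure \<Lambda>" "sigma_finite_measure \<Lambda>'"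
  shows "sets (point_pattern_space \<Lambda>) = sigma_sets (point_patterns \<Lambda>) (cylinders \<Lambda> \<Lambda>')"
proof (rule antisym)
  let ?\<Omega> = "point_patterns \<Lambda>"
  have "cylinders \<Lambda> \<Lambda>' \<subseteq> sets (point_pattern_space \<Lambda>)"
  proof
    fix A assume "A \<in> cylinders \<Lambda> \<Lambda>'"
    then obtain n B E where A: "fin_family \<Lambda> \<Lambda>' n B" "E \<in> sets (PiM {..<n} (\<lambda>_. borel))"
      "A = counts n B -` E \<inter> ?\<Omega>" unfolding cylinders_def by blast
    have "counts n B \<in> point_pattern_space \<Lambda> \<rightarrow>\<^sub>M PiM {..<n} (\<lambda>_. borel)"
      using A(1) by (intro counts_measurable) (simp add: fin_family_def)
    from measurable_sets[OF this A(2)] show "A \<in> sets (point_pattern_space \<Lambda>)" by (simp add: A(3))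
  qed
  from sets.sigma_sets_subset[OF this]
  show "sigma_sets ?\<Omega> (cylinders \<Lambda> \<Lambda>') \<subseteq> sets (point_pattern_space \<Lambda>)" by simp
  define N where "N = sigma ?\<Omega> (cylinders \<Lambda> \<Lambda>')"
  have N: "space N = ?\<Omega>" "sets N = sigma_sets ?\<Omega> (cylinders \<Lambda> \<Lambda>')"
    unfolding N_def by (auto simp: cylinders_def space_measure_of_conv sets_measure_of_conv)
  have fin: "(\<lambda>\<eta>. emeasure \<eta> B) \<in> borel_measurable N"
    if B: "B \<in> sets \<Lambda>" "emeasure \<Lambda> B < \<infinity>" "emeasure \<Lambda>' B < \<infinity>" for B
  proof (rule measurableI)
    fix A :: "ennreal set" assume A: "A \<in> sets borel"
    have "fin_family \<Lambda> \<Lambda>' 1 (\<lambda>_. B)" using B by (auto simp: fin_family_def disjoint_family_on_def)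
    moreover have "(\<lambda>y. y 0) -` A \<inter> space (PiM {..<1::nat} (\<lambda>_. borel)) \<in> sets (PiM {..<1::nat} (\<lambda>_. borel))"
      using A by (intro measurable_sets[OF measurable_component_singleton]) auto
    ultimately have "counts 1 (\<lambda>_. B) -` ((\<lambda>y. y 0) -` A \<inter> space (PiM {..<1::nat} (\<lambda>_. borel))) \<inter> ?\<Omega> \<in> cylinders \<Lambda> \<Lambda>'"
      unfolding cylinders_def by blast
    also have "counts 1 (\<lambda>_. B) -` ((\<lambda>y. y 0) -` A \<inter> space (PiM {..<1::nat} (\<lambda>_. borel))) \<inter> ?\<Omega> = (\<lambda>\<eta>. emeasure \<eta> B) -` A \<inter> space N"
      by (auto simp: counts_def space_PiM N)
    finally show "(\<lambda>\<eta>. emeasure \<eta> B) -` A \<inter> space N \<in> sets N" unfolding N by auto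
  qed auto
  interpret S: sigma_finite_measure "plus_measure \<Lambda> \<Lambda>'" by (rule sigma_finite_plus_measure[OF sets sf])
  obtain S :: "nat \<Rightarrow> _" where S: "range S \<subseteq> sets \<Lambda>" "(\<Union>i. S i) = space \<Lambda>"
    "\<And>i. emeasure (plus_measure \<Lambda> \<Lambda>') (S i) \<noteq> \<infinity>" "disjoint_family S"
    using S.sigma_finite_disjoint by auto
  have meas: "(\<lambda>\<eta>. emeasure \<eta> B) \<in> borel_measurable N" if B: "B \<in> sets \<Lambda>" for B
  proof -
    have BS: "B \<inter> S i \<in> sets \<Lambda>" for i using B S(1) by auto
    have BSf: "emeasure \<Lambda> (B \<inter> S i) < \<infinity>" "emeasure \<Lambda>' (B \<inter> S i) < \<infinity>" for i
    proof -
      have Si: "S i \<in> sets \<Lambda>" using S(1) by auto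
      have "emeasure \<Lambda> (B \<inter> S i) \<le> emeasure \<Lambda> (S i)" "emeasure \<Lambda>' (B \<inter> S i) \<le> emeasure \<Lambda>' (S i)"
        using Si sets by (auto intro!: emeasure_mono)
      moreover have "emeasure \<Lambda> (S i) < \<infinity>" "emeasure \<Lambda>' (S i) < \<infinity>"
        using S(3)[of i] emeasure_plus_measure[OF sets Si] by (auto simp: less_top)
      ultimately show "emeasure \<Lambda> (B \<inter> S i) < \<infinity>" "emeasure \<Lambda>' (B \<inter> S i) < \<infinity>"
        by (auto intro: le_less_trans)
    qed
    have [measurable]: "(\<lambda>\<eta>. emeasure \<eta> (B \<inter> S i)) \<in> borel_measurable N" for i
      using BS BSf by (rule fin)
    have "(\<lambda>\<eta>. \<Sum>i. emeasure \<eta> (B \<inter> S i)) \<in> borel_measurable N" by measurable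
    moreover have "(\<Sum>i. emeasure \<eta> (B \<inter> S i)) = emeasure \<eta> B" if "\<eta> \<in> space N" for \<eta>
    proof -
      have s: "sets \<eta> = sets \<Lambda>" using that N(1) point_pattern_sets by auto
      have "(\<Sum>i. emeasure \<eta> (B \<inter> S i)) = emeasure \<eta> (\<Union>i. B \<inter> S i)"
        using BS S(4) s by (intro suminf_emeasure) (auto simp: disjoint_family_on_def)
      also have "(\<Union>i. B \<inter> S i) = B" using S(2) sets.sets_into_space[OF B] by auto
      finally show ?thesis .
    qed
    ultimately show ?thesis by (simp cong: measurable_cong)
  qed
  have "{(\<lambda>\<eta>. emeasure \<eta> B) -` A \<inter> ?\<Omega> | A B. A \<in> sets borel \<and> B \<in> sets \<Lambda>} \<subseteq> sets N"
    using measurable_sets[OF meas] unfolding N(1) by blast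
  from sets.sigma_sets_subset[OF this]
  show "sets (point_pattern_space \<Lambda>) \<subseteq> sigma_sets ?\<Omega> (cylinders \<Lambda> \<Lambda>')"
    unfolding sets_point_pattern_space N .
qed

section \<open>Common densities, and the identity at orders other than one\<close>

lemma ex_common_density:
  assumes sets: "sets \<Lambda>' = sets \<Lambda>" and sf: "sigma_finite_measure \<Lambda>" "sigma_finite_measure \<Lambda>'"
  obtains \<nu> f g where "sigma_finite_measure \<nu>" "has_density \<nu> \<Lambda> f" "has_density \<nu> \<Lambda>' g"
proof -
  let ?\<nu> = "plus_measure \<Lambda> \<Lambda>'"
  interpret sigma_finite_measure ?\<nu> by (rule sigma_finite_plus_measure[OF sets sf])
  have "\<exists>f. has_density ?\<nu> N f"
    if N: "sigma_finite_measure N" "sets N = sets \<Lambda>" "\<And>A. A \<in> sets \<Lambda> \<Longrightarrow> emeasure N A \<le> emeasure ?\<nu> A" for N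
  proof -
    have "absolutely_continuous ?\<nu> N"
      unfolding absolutely_continuous_def
    proof
      fix A assume "A \<in> null_sets ?\<nu>"
      then have "A \<in> sets \<Lambda>" "emeasure ?\<nu> A = 0" by auto
      then show "A \<in> null_sets N" using N(2) N(3)[of A] by (auto simp: null_sets_def)
    qed
    then obtain h where h: "h \<in> borel_measurable ?\<nu>" "density ?\<nu> h = N"
      using Radon_Nikodym[of N] N(2) by auto
    \<comment> \<open>\<open>has_density\<close> asks for real values; sigma-finiteness of N makes h
      finite almost everywhere, so \<open>enn2real\<close> changes it on a null set only.\<close>
    then have "AE x in ?\<nu>. h x \<noteq> \<infinity>" using N(1) sigma_finite_iff_density_finite[OF h(1)] by simp
    then have "density ?\<nu> h = density ?\<nu> (\<lambda>x. ennreal (enn2real (h x)))"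
      using h(1) by (intro density_cong) (auto simp: less_top elim!: eventually_mono)
    then have "has_density ?\<nu> N (\<lambda>x. enn2real (h x))"
      unfolding has_density_def using h by auto
    then show ?thesis by blast
  qed
  from this[of \<Lambda>] this[of \<Lambda>'] show ?thesis
    using that[OF sigma_finite_measure_axioms] sf sets by (auto simp: emeasure_plus_measure[OF sets])
qed

lemma renyi_of_power_nonneg:
  assumes "0 < \<alpha>" shows "0 \<le> renyi_of_power \<alpha> d"
proof -
  have "renyi_of_power \<alpha> 0 = 0" by (simp add: renyi_of_power_def ext_ln_def zero_ennreal.rep_eq flip: zero_ereal_def)
  then show ?thesis using renyi_of_power_mono[OF assms, of 0 d] by simp
qed

text \<open>Upper bound: disjoint cylinders over a common base are preimages under one count vector,
  whose divergence is explicit and bounded through Jensen's inequality. Lower bound: by data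
  processing every count vector stays below the laws, and suitable count vectors approach the
  supremum for the intensities.\<close>

lemma
  assumes sets: "sets \<Lambda>' = sets \<Lambda>" and sf: "sigma_finite_measure \<Lambda>" "sigma_finite_measure \<Lambda>'"
    and P: "poisson_pp_distribution \<Lambda> P" and Q: "poisson_pp_distribution \<Lambda>' Q"
    and \<alpha>: "0 < \<alpha>" "\<alpha> \<noteq> 1"
  shows var_div_poisson_le: "var_div \<alpha> P Q \<le> power_div \<alpha> (var_div \<alpha> \<Lambda> \<Lambda>')"
    and renyi_var_div_poisson: "renyi_of_power \<alpha> (var_div \<alpha> P Q) = enn2ereal (var_div \<alpha> \<Lambda> \<Lambda>')"
proof -
  have sP: "sets P = sets (point_pattern_space \<Lambda>)" using P by (simp add: poisson_pp_distribution_def)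
  have "sets Q = sets (point_pattern_space \<Lambda>')" using Q by (simp add: poisson_pp_distribution_def)
  then have sQ: "sets Q = sets P" using sP point_pattern_space_cong[OF sets] by simp
  have spP: "space P = point_patterns \<Lambda>" using sets_eq_imp_space_eq[OF sP] by simp
  have finP: "finite_measure P" using P unfolding poisson_pp_distribution_def
    by (auto intro: prob_space.finite_measure)
  have finQ: "finite_measure Q" using Q unfolding poisson_pp_distribution_def
    by (auto intro: prob_space.finite_measure)
  have cP: "counts n B \<in> P \<rightarrow>\<^sub>M PiM {..<n} (\<lambda>_. borel)" if "fin_family \<Lambda> \<Lambda>' n B" for n B
    using counts_measurable[of n B \<Lambda>] that by (simp add: measurable_cong_sets[OF sP refl] fin_family_def)
  have fam': "fin_family \<Lambda>' \<Lambda> n B" if "fin_family \<Lambda> \<Lambda>' n B" for n B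
    using that sets by (simp add: fin_family_def)
  have vd: "var_div \<alpha> (distr P (PiM {..<n} (\<lambda>_. borel)) (counts n B)) (distr Q (PiM {..<n} (\<lambda>_. borel)) (counts n B)) =
    power_div \<alpha> (\<Sum>i<n. tsallis_fun \<alpha> (measure \<Lambda> (B i)) (measure \<Lambda>' (B i)))" if B: "fin_family \<Lambda> \<Lambda>' n B" for n B
    using distr_counts[OF P B] distr_counts[OF Q fam'[OF B]] by (simp add: var_div_poisson_vector[OF \<alpha>])
  obtain \<nu> f g where \<nu>: "sigma_finite_measure \<nu>" "has_density \<nu> \<Lambda> f" "has_density \<nu> \<Lambda>' g"
    using ex_common_density[OF sets sf] .
  have sum_le: "(\<Sum>i<n. tsallis_fun \<alpha> (measure \<Lambda> (B i)) (measure \<Lambda>' (B i))) \<le> var_div \<alpha> \<Lambda> \<Lambda>'"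
    if B: "fin_family \<Lambda> \<Lambda>' n B" for n B
    using sum_tsallis_fun_le_integral[OF \<nu>(2,3) \<alpha> B] by (simp add: integral_eq_var_div[OF \<nu> \<alpha>])
  show le: "var_div \<alpha> P Q \<le> power_div \<alpha> (var_div \<alpha> \<Lambda> \<Lambda>')"
  proof (rule var_div_le_algebra[OF algebra_cylinders[OF sets] finP spP _ finQ sQ])
    show "sets P = sigma_sets (point_patterns \<Lambda>) (cylinders \<Lambda> \<Lambda>')"
      using sP sigma_sets_cylinders[OF sets sf] by simp
    fix m A and t :: "nat \<Rightarrow> real"
    assume "\<And>k. k < m \<Longrightarrow> A k \<in> cylinders \<Lambda> \<Lambda>'" and A: "fin_family P Q m A" and t: "\<And>k. t k > 0"
    then have cyl: "\<forall>k<m. A k \<in> cylinders \<Lambda> \<Lambda>'" by simp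
    obtain n D E where "fin_family \<Lambda> \<Lambda>' n D \<and>
      (\<forall>k<m. E k \<in> sets (PiM {..<n} (\<lambda>_. borel)) \<and> A k = counts n D -` E k \<inter> point_patterns \<Lambda>)"
      using cylinders_common_base[OF sets cyl] by (elim exE)
    then have D: "fin_family \<Lambda> \<Lambda>' n D" and E: "\<And>k. k < m \<Longrightarrow> E k \<in> sets (PiM {..<n} (\<lambda>_. borel))"
      "\<And>k. k < m \<Longrightarrow> A k = counts n D -` E k \<inter> point_patterns \<Lambda>" by simp_all
    let ?N = "PiM {..<n} (\<lambda>_. borel :: ennreal measure)"
    \<comment> \<open>The preimages A k are disjoint but the E k may overlap outside the range of
      the counting map. Removing the earlier ones makes them disjoint without changing any
      preimage.\<close>
    define E' where "E' k = E k - (\<Union>j<k. E j)" for k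
    have E'1: "E' k \<in> sets ?N" if "k < m" for k
      unfolding E'_def using E(1) that by (intro sets.Diff sets.finite_UN) auto
    have dj: "disjoint_family_on E' {..<m}"
      unfolding disjoint_family_on_def E'_def
    proof (intro ballI impI equals0I)
      fix i j x assume "i \<noteq> j" "x \<in> (E i - \<Union> (E ` {..<i})) \<inter> (E j - \<Union> (E ` {..<j}))"
      then show False by (cases "i < j") auto
    qed
    have E'2: "A k = counts n D -` E' k \<inter> space P" if k: "k < m" for k
    proof -
      have "A k \<inter> A j = {}" if "j < k" for j
        using disjoint_family_onD[of A "{..<m}" k j] A that k by (auto simp: fin_family_def)
      then show ?thesis unfolding E'_def spP using E(2) k by fastforce
    qed
    interpret P: finite_measure P by fact
    interpret Q: finite_measure Q by fact
    have fam: "fin_family (distr P ?N (counts n D)) (distr Q ?N (counts n D)) m E'"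
      unfolding fin_family_def using dj E'1 cP[OF D]
      by (auto simp: emeasure_distr measurable_cong_sets[OF sQ refl] simp flip: less_top)
    have "var_val \<alpha> P Q m t A = var_val \<alpha> P Q m t (\<lambda>k. counts n D -` E' k \<inter> space P)"
      unfolding var_val_def by (intro sum.cong) (auto simp: E'2[symmetric])
    also have "\<dots> = var_val \<alpha> (distr P ?N (counts n D)) (distr Q ?N (counts n D)) m t E'"
      by (rule var_val_distr[OF cP[OF D] sQ E'1, symmetric])
    finally have "ennreal (var_val \<alpha> P Q m t A) \<le> var_div \<alpha> (distr P ?N (counts n D)) (distr Q ?N (counts n D))"
      using var_val_le_var_div[OF fam, of t \<alpha>] t by simp
    also have "\<dots> \<le> power_div \<alpha> (var_div \<alpha> \<Lambda> \<Lambda>')"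
      unfolding vd[OF D] by (intro power_div_mono \<alpha> sum_le D)
    finally show "ennreal (var_val \<alpha> P Q m t A) \<le> power_div \<alpha> (var_div \<alpha> \<Lambda> \<Lambda>')" .
  qed
  show "renyi_of_power \<alpha> (var_div \<alpha> P Q) = enn2ereal (var_div \<alpha> \<Lambda> \<Lambda>')"
  proof (rule antisym)
    show "renyi_of_power \<alpha> (var_div \<alpha> P Q) \<le> enn2ereal (var_div \<alpha> \<Lambda> \<Lambda>')"
      using renyi_of_power_mono[OF \<alpha>(1) le] by (simp add: renyi_of_power_power_div[OF \<alpha>])
    \<comment> \<open>The bound is moved to \<open>ennreal\<close>, where the supremum defining
      \<open>var_div\<close> lives; nothing is lost since the left-hand divergence is
      nonnegative.\<close>
    have "var_div \<alpha> \<Lambda> \<Lambda>' \<le> e2ennreal (renyi_of_power \<alpha> (var_div \<alpha> P Q))"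
    proof (rule var_div_least)
      fix m B and t :: "nat \<Rightarrow> real" assume B: "fin_family \<Lambda> \<Lambda>' m B" and t: "\<And>k. t k > 0"
      let ?x = "\<Sum>i<m. tsallis_fun \<alpha> (measure \<Lambda> (B i)) (measure \<Lambda>' (B i))"
      have "power_div \<alpha> ?x \<le> var_div \<alpha> P Q"
        using var_div_distr_le[OF cP[OF B] sQ finP finQ, of \<alpha>] unfolding vd[OF B] .
      then have "enn2ereal ?x \<le> renyi_of_power \<alpha> (var_div \<alpha> P Q)"
        using renyi_of_power_mono[OF \<alpha>(1)] by (metis renyi_of_power_power_div[OF \<alpha>])
      then have "?x \<le> e2ennreal (renyi_of_power \<alpha> (var_div \<alpha> P Q))"
        by (metis e2ennreal_enn2ereal e2ennreal_mono)
      then show "ennreal (var_val \<alpha> \<Lambda> \<Lambda>' m t B) \<le> e2ennreal (renyi_of_power \<alpha> (var_div \<alpha> P Q))"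
        using var_val_le_sum_tsallis_fun[OF \<alpha>, of t] t order_trans by blast
    qed
    then show "enn2ereal (var_div \<alpha> \<Lambda> \<Lambda>') \<le> renyi_of_power \<alpha> (var_div \<alpha> P Q)"
      using renyi_of_power_nonneg[OF \<alpha>(1)] by (simp add: enn2ereal_e2ennreal less_eq_ennreal.rep_eq)
  qed
qed


section \<open>Order one\<close>

text \<open>Order \<open>1\<close> is reached as an increasing limit of orders below \<open>1\<close>.\<close>

definition order_seq :: "nat \<Rightarrow> real" where
  "order_seq n = 1 - 1 / (real n + 2)"

text \<open>The offset 2 makes the first order 1/2, so every order lies strictly between 0 and
  1.\<close>

lemma order_seq: "0 < order_seq n" "order_seq n < 1" "order_seq n \<noteq> 1" "1 - order_seq n = 1 / (real n + 2)"
  by (auto simp: order_seq_def field_simps)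

text \<open>With s = 1 - \<alpha> and L = ln (a / b) the integrand is b - a + a (1 - exp (- L s)) /
  s, a difference quotient whose limit at s = 0 is L.\<close>

lemma tsallis_fun_order_seq:
  assumes "0 < a" "0 < b"
  shows "tsallis_fun (order_seq n) a b =
    ennreal (b - a + a * ((1 - exp (- (ln (a / b) / (real n + 2)))) * (real n + 2)))"
proof -
  let ?s = "1 / (real n + 2)" and ?\<alpha> = "order_seq n"
  have "a powr ?\<alpha> * b powr (1 - ?\<alpha>) = exp (?\<alpha> * ln a + (1 - ?\<alpha>) * ln b)"
    using assms by (simp add: powr_def exp_add)
  also have "?\<alpha> * ln a + (1 - ?\<alpha>) * ln b = ln a - ln (a / b) / (real n + 2)"
    unfolding order_seq(4) unfolding order_seq_def using assms by (simp add: ln_div algebra_simps diff_divide_distrib)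
  also have "exp \<dots> = a * exp (- (ln (a / b) / (real n + 2)))"
    using assms by (simp only: exp_diff exp_minus exp_ln divide_inverse)
  finally have "a powr ?\<alpha> * b powr (1 - ?\<alpha>) = a * exp (- (ln (a / b) / (real n + 2)))" .
  moreover have "(?\<alpha> * a + ?s * b - a * e) / ?s = b - a + a * ((1 - e) * (real n + 2))" for e
  proof -
    have "((1 - s) * a + s * b - a * e) / s = b - a + a * ((1 - e) * (1 / s))" if "s > 0" for s
      using that by (simp add: field_simps)
    from this[of ?s] show ?thesis by (simp add: order_seq_def)
  qed
  ultimately show ?thesis
    using assms order_seq[of n] by (simp add: tsallis_fun_real)
qed

lemma tsallis_fun_order_seq_top:
  assumes "0 < a" shows "tsallis_fun (order_seq n) a 0 = ennreal ((real n + 1) * a)"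
proof -
  have "order_seq n * a / (1 - order_seq n) = (real n + 1) * a"
    unfolding order_seq(4) by (simp add: order_seq_def field_simps)
  then show ?thesis using assms order_seq[of n] by (simp add: tsallis_fun_real)
qed

text \<open>The difference quotient (1 - exp (- L s)) / s grows as s decreases, because exp is
  convex.\<close>

lemma tsallis_fun_order_seq_mono:
  assumes ab: "0 \<le> a" "0 \<le> b" and nm: "n \<le> m"
  shows "tsallis_fun (order_seq n) a b \<le> tsallis_fun (order_seq m) a b"
proof -
  consider "a = 0" | "a > 0" "b = 0" | "a > 0" "b > 0" using ab by fastforce
  then show ?thesis
  proof cases
    case 1 then show ?thesis using ab order_seq by (simp add: tsallis_fun_0_left)
  next
    case 2 then show ?thesis using nm
      by (auto simp: tsallis_fun_order_seq_top intro!: ennreal_leI mult_right_mono)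
  next
    case 3
    have lin: "l * (1 - e) \<le> 1 - e'" if "e' \<le> l * e + (1 - l) * 1" for l e e' :: real
      using that by (simp add: algebra_simps)
    have "(1 - exp (- (L / (real n + 2)))) * (real n + 2) \<le> (1 - exp (- (L / (real m + 2)))) * (real m + 2)" for L :: real
    proof (cases "n = m")
      case False
      \<comment> \<open>The ratio of the two step sizes: Young's inequality with second factor 1 is
        convexity of exp between 0 and - L / (n + 2), evaluated at - L / (m + 2).\<close>
      let ?l = "(real n + 2) / (real m + 2)"
      have l: "0 < ?l" "?l < 1" using False nm by auto
      have "exp (- (L / (real n + 2))) powr ?l * 1 powr (1 - ?l) \<le> ?l * exp (- (L / (real n + 2))) + (1 - ?l) * 1"
        using l by (intro Young_powr) auto
      also have "exp (- (L / (real n + 2))) powr ?l * 1 powr (1 - ?l) = exp (- (L / (real m + 2)))"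
        by (simp add: powr_def)
      finally have "?l * (1 - exp (- (L / (real n + 2)))) \<le> 1 - exp (- (L / (real m + 2)))"
        by (rule lin)
      then have "?l * (1 - exp (- (L / (real n + 2)))) * (real m + 2) \<le> (1 - exp (- (L / (real m + 2)))) * (real m + 2)"
        by (intro mult_right_mono) auto
      moreover have "?l * (1 - exp (- (L / (real n + 2)))) * (real m + 2) = (1 - exp (- (L / (real n + 2)))) * (real n + 2)"
        by simp
      ultimately show ?thesis by (simp only:)
    qed simp
    then show ?thesis using 3 by (auto simp: tsallis_fun_order_seq intro!: ennreal_leI mult_left_mono)
  qed
qed

lemma tsallis_fun_order_seq_tendsto:
  assumes ab: "0 \<le> a" "0 \<le> b"
  shows "(\<lambda>n. tsallis_fun (order_seq n) a b) \<longlonglongrightarrow> tsallis_fun 1 a b"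
proof -
  consider "a = 0" | "a > 0" "b = 0" | "a > 0" "b > 0" using ab by fastforce
  then show ?thesis
  proof cases
    case 1 then show ?thesis using ab order_seq
      by (simp add: tsallis_fun_0_left) (simp add: tsallis_fun_def xln_ratio_def flip: zero_ereal_def)
  next
    case 2
    then have "filterlim (\<lambda>n. (real n + 1) * a) at_top sequentially" by real_asymp
    then have "(\<lambda>n. tsallis_fun (order_seq n) a b) \<longlonglongrightarrow> \<top>"
      using 2 by (simp add: tsallis_fun_order_seq_top ennreal_tendsto_top_eq_at_top)
    moreover have "tsallis_fun 1 a b = \<top>" using 2 by (simp add: tsallis_fun_def xln_ratio_def)
    ultimately show ?thesis by simp
  next
    case 3
    have "(\<lambda>n. (1 - exp (- (L / (real n + 2)))) * (real n + 2)) \<longlonglongrightarrow> L" for L :: real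
      by real_asymp
    then have "(\<lambda>n. b - a + a * ((1 - exp (- (ln (a / b) / (real n + 2)))) * (real n + 2))) \<longlonglongrightarrow> b - a + a * ln (a / b)"
      by (intro tendsto_intros)
    then have "(\<lambda>n. tsallis_fun (order_seq n) a b) \<longlonglongrightarrow> ennreal (b - a + a * ln (a / b))"
      using 3 by (simp add: tsallis_fun_order_seq)
    also have "ennreal (b - a + a * ln (a / b)) = tsallis_fun 1 a b"
      using 3 by (simp add: tsallis_fun_def xln_ratio_def algebra_simps)
    finally show ?thesis .
  qed
qed

text \<open>\<open>tangent\<close> divides by 1 - \<alpha> and is not a supporting plane of the
  integrand at order one, so \<open>var_div\<close> is replaced there by the supremum over lower
  orders.\<close>

definition tsallis_div :: "real \<Rightarrow> 'a measure \<Rightarrow> 'a measure \<Rightarrow> ennreal" where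
  "tsallis_div \<alpha> \<Lambda> \<Lambda>' = (if \<alpha> = 1 then SUP n. var_div (order_seq n) \<Lambda> \<Lambda>' else var_div \<alpha> \<Lambda> \<Lambda>')"

lemma nn_integral_tsallis_fun:
  assumes \<nu>: "sigma_finite_measure \<nu>" and dens: "has_density \<nu> \<Lambda> f" "has_density \<nu> \<Lambda>' g" and \<alpha>: "0 < \<alpha>"
  shows "(\<integral>\<^sup>+x. tsallis_fun \<alpha> (f x) (g x) \<partial>\<nu>) = tsallis_div \<alpha> \<Lambda> \<Lambda>'"
proof (cases "\<alpha> = 1")
  case False then show ?thesis using integral_eq_var_div[OF \<nu> dens \<alpha>] by (simp add: tsallis_div_def)
next
  case True
  note [measurable] = has_density_measurable[OF dens(1)] has_density_measurable[OF dens(2)]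
  have mono: "tsallis_fun (order_seq n) (f x) (g x) \<le> tsallis_fun (order_seq m) (f x) (g x)" if "x \<in> space \<nu>" "n \<le> m" for x n m
    using that has_density_nonneg[OF dens(1)] has_density_nonneg[OF dens(2)] by (intro tsallis_fun_order_seq_mono) auto
  have "(\<integral>\<^sup>+x. tsallis_fun 1 (f x) (g x) \<partial>\<nu>) = (\<integral>\<^sup>+x. (SUP n. tsallis_fun (order_seq n) (f x) (g x)) \<partial>\<nu>)"
  proof (rule nn_integral_cong)
    fix x assume x: "x \<in> space \<nu>"
    then have "(\<lambda>n. tsallis_fun (order_seq n) (f x) (g x)) \<longlonglongrightarrow> tsallis_fun 1 (f x) (g x)"
      using has_density_nonneg[OF dens(1)] has_density_nonneg[OF dens(2)] by (intro tsallis_fun_order_seq_tendsto) auto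
    moreover have "(\<lambda>n. tsallis_fun (order_seq n) (f x) (g x)) \<longlonglongrightarrow> (SUP n. tsallis_fun (order_seq n) (f x) (g x))"
      using mono[OF x] by (intro LIMSEQ_SUP) (auto simp: incseq_def)
    ultimately show "tsallis_fun 1 (f x) (g x) = (SUP n. tsallis_fun (order_seq n) (f x) (g x))"
      by (rule LIMSEQ_unique)
  qed
  also have "\<dots> = (SUP n. \<integral>\<^sup>+x. tsallis_fun (order_seq n) (f x) (g x) \<partial>\<nu>)"
    by (intro nn_integral_monotone_convergence_SUP_AE) (auto intro!: mono)
  also have "\<dots> = tsallis_div \<alpha> \<Lambda> \<Lambda>'"
    using True order_seq by (simp add: tsallis_div_def integral_eq_var_div[OF \<nu> dens])
  finally show ?thesis using True by simp
qed

text \<open>Monotonicity in the order is invisible in the variational form, whose tangents change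
  with the order; it comes from the integrand by way of a common density.\<close>

lemma var_div_order_seq_mono:
  assumes sets: "sets \<Lambda>' = sets \<Lambda>" and sf: "sigma_finite_measure \<Lambda>" "sigma_finite_measure \<Lambda>'" and nm: "n \<le> m"
  shows "var_div (order_seq n) \<Lambda> \<Lambda>' \<le> var_div (order_seq m) \<Lambda> \<Lambda>'"
proof -
  obtain \<nu> f g where \<nu>: "sigma_finite_measure \<nu>" "has_density \<nu> \<Lambda> f" "has_density \<nu> \<Lambda>' g"
    using ex_common_density[OF sets sf] .
  show ?thesis
    using has_density_nonneg[OF \<nu>(2)] has_density_nonneg[OF \<nu>(3)] nm
    by (auto simp: order_seq simp flip: integral_eq_var_div[OF \<nu>] intro!: nn_integral_mono tsallis_fun_order_seq_mono)
qed

text \<open>\<open>tsallis_fun\<close> hides negative values by truncation. Nonnegativity before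
  truncation shows that the negative part in \<open>ext_integral\<close> vanishes.\<close>

lemma tsallis_integrand_nonneg:
  assumes "0 < \<alpha>" "0 \<le> a" "0 \<le> b"
  shows "0 \<le> (if \<alpha> = 1 then xln_ratio a b + ereal b - ereal a
     else (ereal (\<alpha> * a + (1 - \<alpha>) * b) - powr_prod \<alpha> a b) / ereal (1 - \<alpha>))"
proof -
  consider "\<alpha> = 1" | "\<alpha> \<noteq> 1" "\<alpha> < 1 \<or> b > 0" | "\<alpha> > 1" "b = 0" using assms by fastforce
  then show ?thesis
  proof cases
    case 1
    have "a - b \<le> a * ln (a / b)" if "a > 0" "b > 0"
    proof -
      have "ln (b / a) \<le> b / a - 1" using that by (intro ln_le_minus_one) auto
      then have "a * ln (b / a) \<le> a * (b / a - 1)" using that by (intro mult_left_mono) auto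
      also have "\<dots> = b - a" using that by (simp add: field_simps)
      finally show ?thesis using that by (simp add: ln_div algebra_simps)
    qed
    then show ?thesis using 1 assms by (auto simp: xln_ratio_def)
  next
    case 2
    have "b powr (1 - \<alpha>) = 1 / b powr (\<alpha> - 1)" using powr_minus_divide[of b "\<alpha> - 1"] by simp
    then show ?thesis using 2 assms tsallis_fun_nonneg_real[OF assms(1) 2 assms(2,3)]
      by (auto simp: powr_prod_def)
  next
    case 3
    then show ?thesis using assms
      by (cases "a = 0") (auto simp: powr_prod_def divide_ereal_def ereal_mult_eq_PInfty simp flip: zero_ereal_def)
  qed
qed

lemma tsallis_integral_eq:
  assumes \<nu>: "sigma_finite_measure \<nu>" and dens: "has_density \<nu> \<Lambda> f" "has_density \<nu> \<Lambda>' g" and \<alpha>: "0 < \<alpha>"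
  shows "tsallis_integral \<alpha> \<nu> f g = enn2ereal (tsallis_div \<alpha> \<Lambda> \<Lambda>')"
proof -
  let ?h = "\<lambda>x. if \<alpha> = 1 then xln_ratio (f x) (g x) + ereal (g x) - ereal (f x)
     else (ereal (\<alpha> * f x + (1 - \<alpha>) * g x) - powr_prod \<alpha> (f x) (g x)) / ereal (1 - \<alpha>)"
  have "tsallis_integral \<alpha> \<nu> f g = ext_integral \<nu> ?h"
    by (simp add: tsallis_integral_def)
  moreover have "(\<integral>\<^sup>+x. e2ennreal (?h x) \<partial>\<nu>) = tsallis_div \<alpha> \<Lambda> \<Lambda>'"
    using nn_integral_tsallis_fun[OF \<nu> dens \<alpha>] unfolding tsallis_fun_def .
  moreover have "(\<integral>\<^sup>+x. e2ennreal (- ?h x) \<partial>\<nu>) = (\<integral>\<^sup>+x. 0 \<partial>\<nu>)"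
    using tsallis_integrand_nonneg[OF \<alpha> has_density_nonneg[OF dens(1)] has_density_nonneg[OF dens(2)]]
    by (intro nn_integral_cong e2ennreal_neg) (auto simp del: if_split)
  ultimately show ?thesis by (simp add: ext_integral_def zero_ennreal.rep_eq)
qed

text \<open>For probability densities the extra term q - p integrates to 0. As p log (p/q) may have
  an infinite integral, positive and negative parts are compared in an equation of sums.\<close>

lemma renyi_integral_eq_1:
  assumes m: "sigma_finite_measure m" and dens: "has_density m P p" "has_density m Q q"
    and prob: "prob_space P" "prob_space Q"
  shows "renyi_integral 1 m p q = enn2ereal (tsallis_div 1 P Q)"
proof -
  note [measurable] = has_density_measurable[OF dens(1)] has_density_measurable[OF dens(2)]
  let ?pos = "\<lambda>x. e2ennreal (xln_ratio (p x) (q x))" and ?neg = "\<lambda>x. e2ennreal (- xln_ratio (p x) (q x))"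
  have pointwise: "e2ennreal (xln_ratio a b) + ennreal b = tsallis_fun 1 a b + ennreal a + e2ennreal (- xln_ratio a b)"
    and neg_le: "e2ennreal (- xln_ratio a b) \<le> ennreal b" if ab: "0 \<le> a" "0 \<le> b" for a b
  proof -
    consider "a = 0" | "a > 0" "b = 0" | "a > 0" "b > 0" using ab by fastforce
    note cases = this
    have nn: "0 \<le> a * ln (a / b) + b - a" if "a > 0" "b > 0"
      using tsallis_integrand_nonneg[of 1 a b] that by (simp add: xln_ratio_def)
    show "e2ennreal (xln_ratio a b) + ennreal b = tsallis_fun 1 a b + ennreal a + e2ennreal (- xln_ratio a b)"
      using cases
    proof cases
      case 3
      have "ennreal y + ennreal b = ennreal (y + b - a) + ennreal a + ennreal (- y)" if "0 \<le> y + b - a" for y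
        using that 3 by (cases "0 \<le> y") (auto simp: ennreal_neg simp flip: ennreal_plus)
      from this[OF nn] 3 show ?thesis by (simp add: tsallis_fun_def xln_ratio_def)
    qed (use ab in \<open>auto simp: tsallis_fun_def xln_ratio_def simp flip: zero_ereal_def\<close>)
    show "e2ennreal (- xln_ratio a b) \<le> ennreal b"
      using cases
    proof cases
      case 3
      then show ?thesis using nn by (auto simp: xln_ratio_def intro!: ennreal_leI)
    qed (auto simp: xln_ratio_def e2ennreal_neg simp flip: zero_ereal_def)
  qed
  have nn: "0 \<le> p x" "0 \<le> q x" if "x \<in> space m" for x
    using that has_density_nonneg[OF dens(1)] has_density_nonneg[OF dens(2)] by auto
  have int1: "(\<integral>\<^sup>+x. ennreal (p x) \<partial>m) = 1" "(\<integral>\<^sup>+x. ennreal (q x) \<partial>m) = 1"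
    using has_density_nn_integral[OF dens(1) prob(1)] has_density_nn_integral[OF dens(2) prob(2)] .
  \<comment> \<open>From a log (a/b) \<ge> a - b the negative part is at most q, hence
    integrable.\<close>
  have "integral\<^sup>N m ?neg \<le> (\<integral>\<^sup>+x. ennreal (q x) \<partial>m)"
    using neg_le nn by (intro nn_integral_mono) auto
  then have neg_fin: "integral\<^sup>N m ?neg \<noteq> \<top>" unfolding int1 by (auto simp: top_unique)
  have "integral\<^sup>N m ?pos + 1 = (\<integral>\<^sup>+x. ?pos x + ennreal (q x) \<partial>m)"
    by (simp add: nn_integral_add int1)
  also have "\<dots> = (\<integral>\<^sup>+x. tsallis_fun 1 (p x) (q x) + ennreal (p x) + ?neg x \<partial>m)"
    using pointwise nn by (intro nn_integral_cong) auto
  also have "\<dots> = (\<integral>\<^sup>+x. tsallis_fun 1 (p x) (q x) \<partial>m) + 1 + integral\<^sup>N m ?neg"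
    by (simp add: nn_integral_add int1)
  also have "(\<integral>\<^sup>+x. tsallis_fun 1 (p x) (q x) \<partial>m) = tsallis_div 1 P Q"
    by (rule nn_integral_tsallis_fun[OF m dens]) simp
  finally have "1 + integral\<^sup>N m ?pos = 1 + (tsallis_div 1 P Q + integral\<^sup>N m ?neg)"
    by (simp add: ac_simps)
  then have "integral\<^sup>N m ?pos = tsallis_div 1 P Q + integral\<^sup>N m ?neg"
    by (simp add: ennreal_add_left_cancel)
  then have "renyi_integral 1 m p q = enn2ereal (tsallis_div 1 P Q) + enn2ereal (integral\<^sup>N m ?neg) - enn2ereal (integral\<^sup>N m ?neg)"
    by (simp add: renyi_integral_def ext_integral_def plus_ennreal.rep_eq)
  \<comment> \<open>Finiteness of the negative part permits the cancellation in
    \<open>ereal\<close>, even if the divergence is infinite.\<close>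
  also have "\<dots> = enn2ereal (tsallis_div 1 P Q)"
    using neg_fin by (cases "integral\<^sup>N m ?neg"; cases "tsallis_div 1 P Q") auto
  finally show ?thesis .
qed

text \<open>For probability measures the Hellinger integral is 1 + (\<alpha> - 1) times the Tsallis
  divergence, which is the argument of the logarithm in \<open>renyi_of_power\<close>.\<close>

lemma renyi_integral_eq:
  assumes m: "sigma_finite_measure m" and dens: "has_density m P p" "has_density m Q q"
    and prob: "prob_space P" "prob_space Q" and \<alpha>: "0 < \<alpha>"
  shows "renyi_integral \<alpha> m p q = renyi_of_power \<alpha> (tsallis_div \<alpha> P Q)"
proof (cases "\<alpha> = 1")
  case True then show ?thesis using renyi_integral_eq_1[OF m dens prob] by (simp add: renyi_of_power_def)
next
  case False
  let ?H = "\<integral>\<^sup>+x. hellinger_fun \<alpha> (p x) (q x) \<partial>m"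
  have "0 \<le> powr_prod \<alpha> a b" for a b by (simp add: powr_prod_def)
  then have "(\<integral>\<^sup>+x. e2ennreal (- powr_prod \<alpha> (p x) (q x)) \<partial>m) = 0"
    by (simp add: e2ennreal_neg)
  then have R: "renyi_integral \<alpha> m p q = ereal (1 / (\<alpha> - 1)) * ext_ln (enn2ereal ?H)"
    using False by (simp add: renyi_integral_def ext_integral_def hellinger_fun_def zero_ennreal.rep_eq)
  note D = nn_integral_tsallis_fun[OF m dens \<alpha>]
  show ?thesis
  proof (cases "\<alpha> < 1")
    case True
    have H: "ennreal (1 - \<alpha>) * tsallis_div \<alpha> P Q + ?H = 1"
      using tsallis_hellinger_integral_less[OF \<alpha> True dens prob] unfolding D .
    then have "tsallis_div \<alpha> P Q \<noteq> \<top>" "?H \<noteq> \<top>" using True by (auto simp: ennreal_mult_top)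
    then obtain r h where r: "tsallis_div \<alpha> P Q = ennreal r" "0 \<le> r" "?H = ennreal h" "0 \<le> h"
      by (metis ennreal_cases)
    have "ennreal ((1 - \<alpha>) * r + h) = ennreal 1" using H True r by (simp add: ennreal_mult)
    then have "(1 - \<alpha>) * r + h = 1" using r True by (subst (asm) ennreal_inj) auto
    then have "h = 1 + (\<alpha> - 1) * r" by (simp add: algebra_simps)
    then show ?thesis unfolding R using r False by (simp add: renyi_of_power_def)
  next
    case g: False
    then have \<alpha>1: "\<alpha> > 1" using False by simp
    have H: "ennreal (\<alpha> - 1) * tsallis_div \<alpha> P Q + 1 = ?H"
      using tsallis_hellinger_integral_greater[OF \<alpha>1 dens prob] unfolding D .
    show ?thesis
    proof (cases "tsallis_div \<alpha> P Q")
      case (real r)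
      then have "?H = ennreal (1 + (\<alpha> - 1) * r)" using \<alpha>1 unfolding H[symmetric]
        by (simp add: ennreal_mult[symmetric] add.commute)
      then show ?thesis unfolding R using real \<alpha>1 by (simp add: renyi_of_power_def del: ennreal_plus)
    next
      case top
      then have "?H = \<top>" using \<alpha>1 unfolding H[symmetric] by (simp add: ennreal_mult_top)
      then show ?thesis unfolding R using top \<alpha>1 by (simp add: renyi_of_power_def ext_ln_def)
    qed
  qed
qed

text \<open>This is 1 + y \<le> exp y at y = (\<alpha> - 1) r, divided by the negative number
  \<alpha> - 1.\<close>

lemma power_div_le:
  assumes "\<alpha> < 1" shows "power_div \<alpha> x \<le> x"
proof (cases x)
  case (real r)
  have "1 + (\<alpha> - 1) * r \<le> exp ((\<alpha> - 1) * r)" by simp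
  then have "(exp ((\<alpha> - 1) * r) - 1) / (\<alpha> - 1) \<le> r" using assms by (simp add: neg_divide_le_eq algebra_simps)
  then show ?thesis using real by (simp add: power_div_def ennreal_leI)
qed simp

lemma renyi_of_power_order_seq_tendsto:
  assumes "0 \<le> r"
  shows "(\<lambda>n. renyi_of_power (order_seq n) (ennreal r)) \<longlonglongrightarrow> ereal r"
proof (rule Lim_transform_eventually)
  have "(\<lambda>n. - (real n + 2) * ln (1 - r / (real n + 2))) \<longlonglongrightarrow> r" by real_asymp
  then show "(\<lambda>n. ereal (- (real n + 2) * ln (1 - r / (real n + 2)))) \<longlonglongrightarrow> ereal r" by simp
  \<comment> \<open>For small n the logarithm may have a nonpositive argument and the value is then
    infinite; n > r excludes this.\<close>
  have "eventually (\<lambda>n. real n > r) sequentially" by real_asymp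
  then show "eventually (\<lambda>n. ereal (- (real n + 2) * ln (1 - r / (real n + 2))) = renyi_of_power (order_seq n) (ennreal r)) sequentially"
  proof eventually_elim
    case (elim n)
    have *: "1 / (order_seq n - 1) = - (real n + 2)" "(order_seq n - 1) * r = - (r / (real n + 2))"
      by (simp_all add: order_seq_def)
    have "1 - r / (real n + 2) > 0" using elim assms by (simp add: field_simps)
    then show ?case using order_seq(3)[of n] assms * by (simp add: renyi_of_power_def ext_ln_def)
  qed
qed

text \<open>At order one both sides are suprema along the same sequence of orders. The laws stay
  below the intensities at each order since \<open>power_div\<close> lies below the identity.
  Conversely the gap closes in the limit, because \<open>renyi_of_power\<close> at a fixed finite
  argument tends to that argument.\<close>

lemma renyi_tsallis_div_poisson:
  assumes sets: "sets \<Lambda>' = sets \<Lambda>" and sf: "sigma_finite_measure \<Lambda>" "sigma_finite_measure \<Lambda>'"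
    and P: "poisson_pp_distribution \<Lambda> P" and Q: "poisson_pp_distribution \<Lambda>' Q" and \<alpha>: "0 < \<alpha>"
  shows "renyi_of_power \<alpha> (tsallis_div \<alpha> P Q) = enn2ereal (tsallis_div \<alpha> \<Lambda> \<Lambda>')"
proof (cases "\<alpha> = 1")
  case False
  then show ?thesis using renyi_var_div_poisson[OF sets sf P Q \<alpha>] by (simp add: tsallis_div_def)
next
  case True
  let ?d = "\<lambda>n. var_div (order_seq n) P Q" and ?T = "\<lambda>n. var_div (order_seq n) \<Lambda> \<Lambda>'"
  have "?d n \<le> ?T n" for n
    using order_trans[OF var_div_poisson_le[OF sets sf P Q order_seq(1,3)] power_div_le[OF order_seq(2)]] .
  then have "(SUP n. ?d n) \<le> (SUP n. ?T n)" by (intro SUP_mono) auto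
  moreover have "(SUP n. ?T n) \<le> (SUP n. ?d n)"
  proof (cases "SUP n. ?d n")
    case (real r)
    show ?thesis
    proof (rule SUP_least)
      fix n
      \<comment> \<open>Two indices are needed: n is fixed in the supremum, while m tends to
        infinity in the conversion from Tsallis to Renyi.\<close>
      have "enn2ereal (?T n) \<le> renyi_of_power (order_seq m) (ennreal r)" if "n \<le> m" for m
      proof -
        have "enn2ereal (?T n) \<le> enn2ereal (?T m)"
          using var_div_order_seq_mono[OF sets sf that] by (simp add: less_eq_ennreal.rep_eq)
        also have "\<dots> = renyi_of_power (order_seq m) (?d m)"
          by (rule renyi_var_div_poisson[OF sets sf P Q order_seq(1,3), symmetric])
        also have "\<dots> \<le> renyi_of_power (order_seq m) (ennreal r)"
          unfolding real(2)[symmetric] by (intro renyi_of_power_mono order_seq SUP_upper) simp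
        finally show ?thesis .
      qed
      then have "enn2ereal (?T n) \<le> ereal r"
        by (intro tendsto_lowerbound[OF renyi_of_power_order_seq_tendsto[OF real(1)]]) (auto simp: eventually_sequentially)
      then have "?T n \<le> ennreal r" using real(1) by (simp add: less_eq_ennreal.rep_eq)
      then show "?T n \<le> (SUP n. ?d n)" using real(2) by simp
    qed
  next
    case top
    show ?thesis unfolding top by simp
  qed
  ultimately show ?thesis using True by (simp add: tsallis_div_def renyi_of_power_def)
qed


section \<open>Kernel products and the main theorem\<close>

lemma sets_measure_kernel_prod [simp]: "sets (measure_kernel_prod lam S\<^sub>2 K) = sets (lam \<Otimes>\<^sub>M S\<^sub>2)"
  unfolding measure_kernel_prod_def
  using sets.sigma_sets_eq[of "lam \<Otimes>\<^sub>M S\<^sub>2"] sets.space_closed[of "lam \<Otimes>\<^sub>M S\<^sub>2"]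
  by (simp add: space_pair_measure)

text \<open>\<open>measure_of\<close> yields the zero measure if the given set function is not a
  measure, so countable additivity has to be verified before the formula can be used.\<close>

lemma emeasure_measure_kernel_prod:
  assumes K: "K \<in> lam \<rightarrow>\<^sub>M prob_algebra S\<^sub>2" and C: "C \<in> sets (lam \<Otimes>\<^sub>M S\<^sub>2)"
  shows "emeasure (measure_kernel_prod lam S\<^sub>2 K) C = (\<integral>\<^sup>+x. \<integral>\<^sup>+y. indicator C (x, y) \<partial>K x \<partial>lam)"
  unfolding measure_kernel_prod_def
proof (rule emeasure_measure_of_sigma)
  show "sigma_algebra (space lam \<times> space S\<^sub>2) (sets (lam \<Otimes>\<^sub>M S\<^sub>2))"
    using sets.sigma_algebra_axioms[of "lam \<Otimes>\<^sub>M S\<^sub>2"] by (simp add: space_pair_measure)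
  show "countably_additive (sets (lam \<Otimes>\<^sub>M S\<^sub>2)) (\<lambda>C. \<integral>\<^sup>+x. \<integral>\<^sup>+y. indicator C (x, y) \<partial>K x \<partial>lam)"
  proof (rule countably_additiveI)
    fix A :: "nat \<Rightarrow> _" assume A: "range A \<subseteq> sets (lam \<Otimes>\<^sub>M S\<^sub>2)" "disjoint_family A"
    then have [measurable]: "A i \<in> sets (lam \<Otimes>\<^sub>M S\<^sub>2)" for i by auto
    have K' [measurable]: "K \<in> lam \<rightarrow>\<^sub>M subprob_algebra S\<^sub>2" using K by (rule measurable_prob_algebraD)
    have [measurable]: "(\<lambda>x. \<integral>\<^sup>+y. indicator (A i) (x, y) \<partial>K x) \<in> borel_measurable lam" for i
      by (rule nn_integral_measurable_subprob_algebra2[OF _ K']) measurable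
    have "(\<Sum>i. \<integral>\<^sup>+x. \<integral>\<^sup>+y. indicator (A i) (x, y) \<partial>K x \<partial>lam) = (\<integral>\<^sup>+x. (\<Sum>i. \<integral>\<^sup>+y. indicator (A i) (x, y) \<partial>K x) \<partial>lam)"
      by (intro nn_integral_suminf[symmetric]) measurable
    also have "\<dots> = (\<integral>\<^sup>+x. \<integral>\<^sup>+y. indicator (\<Union>i. A i) (x, y) \<partial>K x \<partial>lam)"
    proof (rule nn_integral_cong)
      fix x assume x: "x \<in> space lam"
      have s: "sets (K x) = sets S\<^sub>2" using measurable_space[OF K x] by (simp add: space_prob_algebra)
      have "(\<lambda>y. indicator (A i) (x, y) :: ennreal) \<in> borel_measurable (K x)" for i
        unfolding measurable_cong_sets[OF s refl] using x by measurable
      then have "(\<Sum>i. \<integral>\<^sup>+y. indicator (A i) (x, y) \<partial>K x) = (\<integral>\<^sup>+y. (\<Sum>i. indicator (A i) (x, y)) \<partial>K x)"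
        by (intro nn_integral_suminf[symmetric])
      then show "(\<Sum>i. \<integral>\<^sup>+y. indicator (A i) (x, y) \<partial>K x) = (\<integral>\<^sup>+y. indicator (\<Union>i. A i) (x, y) \<partial>K x)"
        by (simp add: suminf_indicator[OF A(2)])
    qed
    finally show "(\<Sum>i. \<integral>\<^sup>+x. \<integral>\<^sup>+y. indicator (A i) (x, y) \<partial>K x \<partial>lam) =
      (\<integral>\<^sup>+x. \<integral>\<^sup>+y. indicator (\<Union>i. A i) (x, y) \<partial>K x \<partial>lam)" .
  qed
qed (use C in \<open>auto simp: positive_def\<close>)

text \<open>A strip over a set a has mass at most lam(a) because the kernel has total mass
  1.\<close>

lemma sigma_finite_measure_kernel_prod:
  assumes K: "K \<in> lam \<rightarrow>\<^sub>M prob_algebra S\<^sub>2" and lam: "sigma_finite_measure lam"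
  shows "sigma_finite_measure (measure_kernel_prod lam S\<^sub>2 K)"
proof -
  obtain A where A: "countable A" "A \<subseteq> sets lam" "\<Union>A = space lam" "\<forall>a\<in>A. emeasure lam a \<noteq> \<infinity>"
    using sigma_finite_measure.sigma_finite_countable[OF lam] by auto
  have sp: "space (measure_kernel_prod lam S\<^sub>2 K) = space lam \<times> space S\<^sub>2"
    using sets_eq_imp_space_eq[OF sets_measure_kernel_prod] by (simp add: space_pair_measure)
  show ?thesis
  proof (standard, intro exI[of _ "(\<lambda>a. a \<times> space S\<^sub>2) ` A"] conjI ballI)
    show "\<Union> ((\<lambda>a. a \<times> space S\<^sub>2) ` A) = space (measure_kernel_prod lam S\<^sub>2 K)"
      unfolding sp A(3)[symmetric] by blast
    fix c assume "c \<in> (\<lambda>a. a \<times> space S\<^sub>2) ` A"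
    then obtain a where c: "c = a \<times> space S\<^sub>2" "a \<in> A" by auto
    then have a: "a \<in> sets lam" using A(2) by auto
    have "emeasure (measure_kernel_prod lam S\<^sub>2 K) c = (\<integral>\<^sup>+x. \<integral>\<^sup>+y. indicator c (x, y) \<partial>K x \<partial>lam)"
      using a by (intro emeasure_measure_kernel_prod K) (simp add: c(1))
    also have "\<dots> \<le> (\<integral>\<^sup>+x. indicator a x \<partial>lam)"
    proof (rule nn_integral_mono)
      fix x assume x: "x \<in> space lam"
      then interpret prob_space "K x" using measurable_space[OF K x] by (simp add: space_prob_algebra)
      have "(\<integral>\<^sup>+y. indicator c (x, y) \<partial>K x) \<le> (\<integral>\<^sup>+y. indicator a x \<partial>K x)"
        by (intro nn_integral_mono) (auto simp: c(1) indicator_def)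
      then show "(\<integral>\<^sup>+y. indicator c (x, y) \<partial>K x) \<le> indicator a x" by (simp add: emeasure_space_1)
    qed
    also have "\<dots> = emeasure lam a" using a by simp
    finally show "emeasure (measure_kernel_prod lam S\<^sub>2 K) c \<noteq> \<infinity>"
      using A(4) c(2) by (auto simp: top_unique)
  qed (use A in auto)
qed

text \<open>The definite description denotes: the sum of the measures dominates both, and each
  choice of densities yields the same density-free value.\<close>

lemma tsallis_divergence_eq:
  assumes "sets \<Lambda>' = sets \<Lambda>" "sigma_finite_measure \<Lambda>" "sigma_finite_measure \<Lambda>'" "0 < \<alpha>"
  shows "tsallis_divergence \<alpha> \<Lambda> \<Lambda>' = enn2ereal (tsallis_div \<alpha> \<Lambda> \<Lambda>')"
proof -
  obtain \<nu> f g where "sigma_finite_measure \<nu>" "has_density \<nu> \<Lambda> f" "has_density \<nu> \<Lambda>' g"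
    using ex_common_density[OF assms(1-3)] .
  then show ?thesis unfolding tsallis_divergence_def
    using tsallis_integral_eq[OF _ _ _ \<open>0 < \<alpha>\<close>] by (intro the_equality) (fastforce, blast)
qed

lemma renyi_divergence_eq:
  assumes "sets Q = sets P" and P: "prob_space P" and Q: "prob_space Q" and "0 < \<alpha>"
  shows "renyi_divergence \<alpha> P Q = renyi_of_power \<alpha> (tsallis_div \<alpha> P Q)"
proof -
  obtain m p q where "sigma_finite_measure m" "has_density m P p" "has_density m Q q"
    using ex_common_density[OF assms(1) prob_space_imp_sigma_finite[OF P] prob_space_imp_sigma_finite[OF Q]] .
  then show ?thesis unfolding renyi_divergence_def
    using renyi_integral_eq[OF _ _ _ P Q \<open>0 < \<alpha>\<close>] by (intro the_equality) (fastforce, blast)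
qed

theorem theorem6p2:
  fixes S\<^sub>1 :: "'a measure" and S\<^sub>2 :: "'b measure"
    and lam \<mu> :: "'a measure" and K L :: "'a \<Rightarrow> 'b measure"
    and M :: "'w measure" and \<xi> :: "'w \<Rightarrow> ('a \<times> 'b) measure"
    and M' :: "'v measure" and \<zeta> :: "'v \<Rightarrow> ('a \<times> 'b) measure"
    and \<alpha> :: real
  assumes "sets lam = sets S\<^sub>1" and "sigma_finite_measure lam"
    and "sets \<mu> = sets S\<^sub>1" and "sigma_finite_measure \<mu>"
    and "K \<in> S\<^sub>1 \<rightarrow>\<^sub>M prob_algebra S\<^sub>2" and "L \<in> S\<^sub>1 \<rightarrow>\<^sub>M prob_algebra S\<^sub>2"
    and "marked_poisson_pp M S\<^sub>1 S\<^sub>2 lam K \<xi>"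
    and "marked_poisson_pp M' S\<^sub>1 S\<^sub>2 \<mu> L \<zeta>"
    and "\<alpha> > 0"
  shows "renyi_divergence \<alpha> (law_pp M (S\<^sub>1 \<Otimes>\<^sub>M S\<^sub>2) \<xi>) (law_pp M' (S\<^sub>1 \<Otimes>\<^sub>M S\<^sub>2) \<zeta>) =
         tsallis_divergence \<alpha> (measure_kernel_prod lam S\<^sub>2 K) (measure_kernel_prod \<mu> S\<^sub>2 L)"
proof -
  let ?P = "law_pp M (S\<^sub>1 \<Otimes>\<^sub>M S\<^sub>2) \<xi>" and ?Q = "law_pp M' (S\<^sub>1 \<Otimes>\<^sub>M S\<^sub>2) \<zeta>"
  let ?\<Lambda> = "measure_kernel_prod lam S\<^sub>2 K" and ?\<Lambda>' = "measure_kernel_prod \<mu> S\<^sub>2 L"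
  have "K \<in> lam \<rightarrow>\<^sub>M prob_algebra S\<^sub>2" "L \<in> \<mu> \<rightarrow>\<^sub>M prob_algebra S\<^sub>2"
    unfolding measurable_cong_sets[OF assms(1) refl] measurable_cong_sets[OF assms(3) refl] by fact+
  then have sf: "sigma_finite_measure ?\<Lambda>" "sigma_finite_measure ?\<Lambda>'"
    using sigma_finite_measure_kernel_prod assms(2,4) by auto
  have sets: "sets ?\<Lambda>' = sets ?\<Lambda>"
    using assms(1,3) by (simp cong: sets_pair_measure_cong)
  have PQ: "poisson_pp_distribution ?\<Lambda> ?P" "poisson_pp_distribution ?\<Lambda>' ?Q"
    using assms(7,8) by (auto simp: marked_poisson_pp_def)
  have prob: "prob_space ?P" "prob_space ?Q" using PQ by (auto simp: poisson_pp_distribution_def)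
  have "sets ?Q = sets ?P" by (simp add: law_pp_def)
  from renyi_divergence_eq[OF this prob \<open>\<alpha> > 0\<close>] tsallis_divergence_eq[OF sets sf \<open>\<alpha> > 0\<close>]
  show ?thesis using renyi_tsallis_div_poisson[OF sets sf PQ \<open>\<alpha> > 0\<close>] by simp
qed

end
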